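(* Let $\beta>0$. Let $m,n\to\infty$ (with $n=n_m$ and $P=P_m$ depending on $m$) so that $mn^{-1}\to\beta$. Let $X_1$ have distribution $P$, and let $d=d(w_1)$ be the degree of $w_1$ in the passive random intersection graph $G^*_1(n,m,P)$. Suppose that $X_1$ converges in distribution to a random variable $Z$, that $0<\mathbf E Z^2<\infty$, and that $\lim_{m\to\infty}\mathbf E X_1^2=\mathbf E Z^2$. Let $d_*=\sum_{j=1}^{\Lambda}\tilde Z_j$, where $\tilde Z_1,\tilde Z_2,\dots$ are independent random variables with common distribution $\tilde P_Z$, and $\Lambda$ is independent of this sequence and has Poisson distribution with mean $\beta^{-1}\mathbf E Z$. Then $d$ converges in distribution to $d_*$. Moreover: (a) in the case where $\mathbf P(Z\ge2)>0$, $\mathbf E Z^3<\infty$ and $\lim_{m\to\infty}\mathbf E X_1^3=\mathbf E Z^3$, we have $$\alpha^*(n,m,P)=\frac{\mathbf E (d_* )_2-(\mathbf E d_* )^2}{\mathbf E(d_* )_2}+o(1);$$ (b) in the case where $\mathbf E Z^3=\infty$, we have $\alpha^*(n,m,P)=1+o(1)$.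
   Context: Passive random intersection graph $G^*_1(n,m,P)$: let $W=\{w_1,\dots,w_m\}$ and let $P$ be a probability distribution on $\{0,1,\dots,m\}$. Let $D_1,\dots,D_n$ be independent identically distributed random subsets of $W$ with $\mathbf P(D_i=A)=P(|A|)\binom{m}{|A|}^{-1}$ for each $A\subset W$; write $X_i=|D_i|$, so $X_i$ has distribution $P$. The vertex set is $W$; distinct $w,w'\in W$ are adjacent ($w\sim w'$) iff $\{w,w'\}\subset D_j$ for at least one $j$. Clustering coefficient: $\alpha^*(n,m,P)=\mathbf P(w_2\sim w_3\mid w_1\sim w_2,\ w_1\sim w_3)$. Notation: $(x)_2=x(x-1)$. For a random variable $Z$ with values in $\{0,1,2,\dots\}$ and $0<\mathbf E Z<\infty$, the distribution $\tilde P_Z$ on $\{0,1,2,\dots\}$ puts mass $(j+1)\mathbf P(Z=j+1)/\mathbf E Z$ on $j=0,1,2,\dots$. *)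

theory Defs
  imports "HOL-Probability.Probability"
begin

section \<open>The passive random intersection graph\<close>

text \<open>
  The vertex set $W = \{w_1,\dots,w_m\}$ is represented by \<open>{1..m}\<close>.
  A random subset is drawn by choosing its size from \<open>P\<close> and then a uniform subset of that
  size; \<open>pmf_random_subset_pmf\<close> below gives the point probabilities. The definition is only
  meaningful when \<open>P\<close> is supported on \<open>{0..m}\<close>.
\<close>

definition random_subset_pmf :: "nat \<Rightarrow> nat pmf \<Rightarrow> nat set pmf" where
  "random_subset_pmf m P = bind_pmf P (\<lambda>k. pmf_of_set {A. A \<subseteq> {1..m} \<and> card A = k})"

lemma pmf_random_subset_pmf:
  assumes "set_pmf P \<subseteq> {0..m}" and A: "A \<subseteq> {1..m}"
  shows "pmf (random_subset_pmf m P) A = pmf P (card A) / real (m choose card A)"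
proof -
  have le: "card A \<le> m" using card_mono[OF _ A] by simp
  have fin: "finite {B. B \<subseteq> {1..m} \<and> card B = k}" for k
    by (rule finite_subset[of _ "Pow {1..m}"]) auto
  have ne: "{B. B \<subseteq> {1..m} \<and> card B = k} \<noteq> {}" if "k \<le> m" for k
    using that by (auto intro!: exI[of _ "{1..k}"])
  have c: "card {B. B \<subseteq> {1..m} \<and> card B = k} = m choose k" for k
    using n_subsets[of "{1..m}" k] by simp
  have "pmf (random_subset_pmf m P) A
      = (\<Sum>k\<in>{0..m}. pmf P k * pmf (pmf_of_set {B. B \<subseteq> {1..m} \<and> card B = k}) A)"
    unfolding random_subset_pmf_def pmf_bind
    by (subst integral_measure_pmf[of "{0..m}"]) (use assms(1) in auto)
  also have "\<dots> = (\<Sum>k\<in>{0..m}. if k = card A then pmf P k / real (m choose k) else 0)"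
    by (rule sum.cong)
      (use A in \<open>simp_all add: pmf_of_set[OF ne fin] c indicator_def del: One_nat_def\<close>)
  also have "\<dots> = pmf P (card A) / real (m choose card A)"
    using le by simp
  finally show ?thesis .
qed

text \<open>The joint law of the independent subsets $D_1,\dots,D_n$, as a function of the index.\<close>

definition intersection_sample_pmf :: "nat \<Rightarrow> nat \<Rightarrow> nat pmf \<Rightarrow> (nat \<Rightarrow> nat set) pmf" where
  "intersection_sample_pmf n m P = Pi_pmf {1..n} {} (\<lambda>_. random_subset_pmf m P)"

definition passive_adj :: "nat \<Rightarrow> (nat \<Rightarrow> nat set) \<Rightarrow> nat \<Rightarrow> nat \<Rightarrow> bool" where
  "passive_adj n D w w' \<longleftrightarrow> w \<noteq> w' \<and> (\<exists>j\<in>{1..n}. {w, w'} \<subseteq> D j)"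

definition passive_degree :: "nat \<Rightarrow> nat \<Rightarrow> (nat \<Rightarrow> nat set) \<Rightarrow> nat \<Rightarrow> nat" where
  "passive_degree n m D w = card {w' \<in> {1..m}. passive_adj n D w w'}"

text \<open>
  The vertices $w_1, w_2, w_3$ are \<open>1\<close>, \<open>2\<close>, \<open>3\<close>, so this requires \<open>m \<ge> 3\<close>;
  the value is \<open>0\<close> if the conditioning event has probability zero.
\<close>

definition clustering_coeff :: "nat \<Rightarrow> nat \<Rightarrow> nat pmf \<Rightarrow> real" where
  "clustering_coeff n m P =
     \<P>(D in measure_pmf (intersection_sample_pmf n m P).
        passive_adj n D 2 3 \<bar> passive_adj n D 1 2 \<and> passive_adj n D 1 3)"

section \<open>The shifted size-biased distribution\<close>

text \<open>
  \<open>Q\<close> is the law of a random variable $Z$. If $0 < \mathbf{E} Z < \infty$, then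
  \<open>embed_pmf\<close> is applied to a genuine probability mass function
  (see \<open>pmf_size_biased_pmf\<close>); otherwise the value is irrelevant.
\<close>

definition size_biased_pmf :: "nat pmf \<Rightarrow> nat pmf" where
  "size_biased_pmf Q =
     embed_pmf (\<lambda>j. real (j + 1) * pmf Q (j + 1) / measure_pmf.expectation Q real)"

lemma pmf_size_biased_pmf:
  assumes int: "integrable (measure_pmf Q) real" and pos: "measure_pmf.expectation Q real > 0"
  shows "pmf (size_biased_pmf Q) j =
           real (j + 1) * pmf Q (j + 1) / measure_pmf.expectation Q real"
proof -
  let ?E = "measure_pmf.expectation Q real"
  let ?f = "\<lambda>j. real (j + 1) * pmf Q (j + 1) / ?E"
  have s: "(\<lambda>k. pmf Q k * real k) sums ?E"
  proof -
    have i: "integrable (count_space UNIV) (\<lambda>k. pmf Q k * real k)"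
      using int by (subst (asm) measure_pmf_eq_density) (subst (asm) integrable_density; simp)
    have "(\<lambda>k. pmf Q k * real k) sums (\<integral>k. pmf Q k * real k \<partial>count_space UNIV)"
      by (rule sums_integral_count_space_nat[OF i])
    also have "(\<integral>k. pmf Q k * real k \<partial>count_space UNIV) = ?E"
      unfolding measure_pmf_eq_density by (subst integral_density) auto
    finally show ?thesis .
  qed
  have "(\<lambda>k. pmf Q (Suc k) * real (Suc k)) sums ?E"
    using s by (subst sums_Suc_iff) simp
  from sums_divide[OF this, of ?E] have "?f sums 1"
    using pos by (simp add: mult.commute)
  then have "(\<Sum>j. ennreal (?f j)) = 1"
    using pos by (subst suminf_ennreal_eq) auto
  then have "(\<integral>\<^sup>+ j. ennreal (?f j) \<partial>count_space UNIV) = 1"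
    by (simp add: nn_integral_count_space_nat)
  then show ?thesis
    unfolding size_biased_pmf_def using pos by (intro pmf_embed_pmf) auto
qed

end

theory Submission
  imports Defs "HOL-Real_Asymp.Real_Asymp"
begin

text \<open>
  The degree of \<open>w\<^sub>1\<close> equals the sum of \<open>|D\<^sub>j| - 1\<close> over the sets \<open>D\<^sub>j\<close> containing \<open>w\<^sub>1\<close>, unless two of these
  sets share a second element, which by a union bound has probability \<open>O(1/m)\<close>. The sum has \<open>n\<close>
  i.i.d. terms with characteristic function \<open>1 - a\<^sub>m(t)/m\<close>, where
  \<open>a\<^sub>m(t) = E X\<^sub>1(1 - exp(it(X\<^sub>1 - 1)))\<close>. Convergence of the second moments makes \<open>X\<^sub>1\<^sup>2\<close> uniformly
  integrable, so the \<open>n\<close>-th power tends to \<open>exp(- E Z(1 - exp(it(Z - 1))) / \<beta>)\<close>, which is the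
  characteristic function of the compound Poisson variable \<open>d\<^sub>*\<close>; Levy's continuity theorem applies.

  Let \<open>u\<close> and \<open>v\<close> be the probabilities that \<open>D\<^sub>1\<close> contains two, respectively three, given vertices.
  By inclusion-exclusion, \<open>w\<^sub>1\<close> has both neighbours \<open>w\<^sub>2, w\<^sub>3\<close> with probability
  \<open>1 - 2(1-u)\<^sup>n + (1-2u+v)\<^sup>n \<approx> nv + (nu)\<^sup>2\<close>, and all three are adjacent with probability
  \<open>1 - 3(1-u)\<^sup>n + 3(1-2u+v)\<^sup>n - (1-3u+2v)\<^sup>n \<approx> nv\<close>. Now \<open>nmu \<rightarrow> E(Z)\<^sub>2/\<beta>\<close>, while \<open>nm\<^sup>2v\<close> tends to
  \<open>E(Z)\<^sub>3/\<beta>\<close> in case (a) and to infinity in case (b).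
\<close>


section \<open>Convergence of expectations on the natural numbers\<close>

text \<open>The limit law has no atoms at half-integers, so its distribution function is continuous
  at \<open>k - 1/2\<close> and \<open>k + 1/2\<close>, and the mass at \<open>k\<close> is the
  increment between these two points.\<close>

lemma weak_conv_m_imp_pmf_tendsto:
  fixes P :: "nat \<Rightarrow> nat pmf" and Q :: "nat pmf"
  assumes "weak_conv_m (\<lambda>m. distr (measure_pmf (P m)) borel real) (distr (measure_pmf Q) borel real)"
  shows "(\<lambda>m. pmf (P m) k) \<longlonglongrightarrow> pmf Q k"
proof -
  have cdf: "cdf (distr (measure_pmf R) borel real) x = measure_pmf.prob R {z. real z \<le> x}"
    for R :: "nat pmf" and x
    by (simp add: cdf_def measure_distr vimage_def)
  interpret Q: real_distribution "distr (measure_pmf Q) borel real"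
    by (intro prob_space.real_distribution_distr measure_pmf.prob_space_axioms) simp
  have noninteger: "{z. real z = real k + s} = {}" if "s = 1/2 \<or> s = -1/2" for s
  proof (safe)
    fix z assume "real z = real k + s"
    \<comment> \<open>Doubling turns the equation into one between an even and an odd
      integer.\<close>
    then have "real_of_int (2 * int z) = real_of_int (2 * int k + (if s = 1/2 then 1 else -1))"
      using that by auto
    then have "2 * int z = 2 * int k + (if s = 1/2 then 1 else -1)"
      by (rule of_int_eq_iff[THEN iffD1])
    then show "z \<in> {}"
      by (simp split: if_splits) presburger+
  qed
  have lim: "(\<lambda>m. measure_pmf.prob (P m) {z. real z \<le> real k + s})
      \<longlonglongrightarrow> measure_pmf.prob Q {z. real z \<le> real k + s}" if "s = 1/2 \<or> s = -1/2" for s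
  proof -
    have "isCont (cdf (distr (measure_pmf Q) borel real)) (real k + s)"
      unfolding Q.isCont_cdf using noninteger[OF that] by (simp add: measure_distr vimage_def)
    then show ?thesis
      using assms unfolding weak_conv_m_def weak_conv_def cdf by blast
  qed
  have pmf_cdf: "pmf R k = measure_pmf.prob R {z. real z \<le> real k + 1/2}
      - measure_pmf.prob R {z. real z \<le> real k + (-1/2)}" for R :: "nat pmf"
  proof -
    have "{k} = {z. real z \<le> real k + 1/2} - {z. real z \<le> real k + (-1/2)}"
    proof (intro set_eqI iffI)
      fix z assume "z \<in> {z. real z \<le> real k + 1/2} - {z. real z \<le> real k + (-1/2)}"
      then have "real z < real (Suc k)" "real k < real (Suc z)" by auto
      then show "z \<in> {k}" by simp
    qed simp
    then have "pmf R k = measure_pmf.prob R ({z. real z \<le> real k + 1/2} - {z. real z \<le> real k + (-1/2)})"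
      by (metis measure_pmf_single)
    also have "\<dots> = measure_pmf.prob R {z. real z \<le> real k + 1/2}
      - measure_pmf.prob R {z. real z \<le> real k + (-1/2)}"
      by (rule measure_pmf.finite_measure_Diff) auto
    finally show ?thesis .
  qed
  show ?thesis
    unfolding pmf_cdf by (intro tendsto_diff lim) auto
qed

lemma sums_pmf_expectation:
  fixes g :: "nat \<Rightarrow> 'b::{banach, second_countable_topology}"
  assumes "integrable (measure_pmf Q) g"
  shows "(\<lambda>k. pmf Q k *\<^sub>R g k) sums measure_pmf.expectation Q g"
proof -
  have i: "integrable (count_space UNIV) (\<lambda>k. pmf Q k *\<^sub>R g k)"
    using assms by (subst (asm) measure_pmf_eq_density) (subst (asm) integrable_density; simp)
  have "measure_pmf.expectation Q g = (\<integral>k. pmf Q k *\<^sub>R g k \<partial>count_space UNIV)"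
    unfolding measure_pmf_eq_density by (subst integral_density) auto
  then show ?thesis
    using sums_integral_count_space_nat[OF i] by simp
qed

text \<open>Both sides are tails of series, compared term by term. Writing the tail of
  \<open>h\<close> as full expectation minus partial sum lets it be controlled uniformly over
  converging laws.\<close>

lemma norm_expectation_diff_partial_sum_le:
  fixes g :: "nat \<Rightarrow> 'b::{banach, second_countable_topology}"
  assumes h: "integrable (measure_pmf Q) h" and gh: "\<And>k. norm (g k) \<le> h k"
  shows "norm (measure_pmf.expectation Q g - (\<Sum>k<K. pmf Q k *\<^sub>R g k))
      \<le> measure_pmf.expectation Q h - (\<Sum>k<K. pmf Q k * h k)"
proof -
  have g: "integrable (measure_pmf Q) g"
    by (rule Bochner_Integration.integrable_bound[OF h]) (use gh in \<open>auto intro!: AE_I2 order_trans[OF _ abs_ge_self]\<close>)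
  have "(\<lambda>k. pmf Q (k + K) *\<^sub>R g (k + K)) sums (measure_pmf.expectation Q g - (\<Sum>k<K. pmf Q k *\<^sub>R g k))"
    using sums_split_initial_segment[OF sums_pmf_expectation[OF g]] .
  moreover have "(\<lambda>k. pmf Q (k + K) * h (k + K)) sums (measure_pmf.expectation Q h - (\<Sum>k<K. pmf Q k * h k))"
    using sums_split_initial_segment[OF sums_pmf_expectation[OF h]] by simp
  moreover have "norm (pmf Q (k + K) *\<^sub>R g (k + K)) \<le> pmf Q (k + K) * h (k + K)" for k
    using gh by (simp add: mult_left_mono)
  ultimately show ?thesis
    by (metis (no_types, lifting) norm_suminf_le sums_iff)
qed

text \<open>Dominated convergence in which the law varies instead of the integrand. Convergence of
  the expectation of \<open>h\<close> plays the part of uniform integrability: it forces the tails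
  of \<open>h\<close> under \<open>P m\<close> to approach those under \<open>Q\<close>.\<close>

lemma tendsto_expectation_dominated:
  fixes g :: "nat \<Rightarrow> 'b::{banach, second_countable_topology}"
  assumes conv: "\<And>k. (\<lambda>m. pmf (P m) k) \<longlonglongrightarrow> pmf Q k"
    and hP: "\<And>m. integrable (measure_pmf (P m)) h" and hQ: "integrable (measure_pmf Q) h"
    and h_lim: "(\<lambda>m. measure_pmf.expectation (P m) h) \<longlonglongrightarrow> measure_pmf.expectation Q h"
    and gh: "\<And>k. norm (g k) \<le> h k"
  shows "(\<lambda>m. measure_pmf.expectation (P m) g) \<longlonglongrightarrow> measure_pmf.expectation Q g"
proof (rule tendstoI)
  fix e :: real assume "e > 0"
  let ?S = "\<lambda>R K. \<Sum>k<K. pmf R k *\<^sub>R g k" and ?H = "\<lambda>R K. \<Sum>k<K. pmf R k * h k"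
  have "(\<lambda>K. measure_pmf.expectation Q h - ?H Q K) \<longlonglongrightarrow> measure_pmf.expectation Q h - measure_pmf.expectation Q h"
    using sums_pmf_expectation[OF hQ] by (intro tendsto_diff tendsto_const) (simp add: sums_def)
  then have "\<forall>\<^sub>F K in sequentially. measure_pmf.expectation Q h - ?H Q K < e / 2"
    using \<open>e > 0\<close> by (intro order_tendstoD) auto
  then obtain K where K: "measure_pmf.expectation Q h - ?H Q K < e / 2"
    by (auto dest: eventually_happens)
  \<comment> \<open>The cutoff \<open>K\<close> depends on \<open>Q\<close> only. As
    \<open>m\<close> grows the first term vanishes and the tail under \<open>P m\<close> turns into
    the tail under \<open>Q\<close>, so the whole bound tends to twice a quantity below
    \<open>e / 2\<close>.\<close>
  have "(\<lambda>m. norm (?S (P m) K - ?S Q K) + (measure_pmf.expectation (P m) h - ?H (P m) K)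
        + (measure_pmf.expectation Q h - ?H Q K))
      \<longlonglongrightarrow> norm (?S Q K - ?S Q K) + (measure_pmf.expectation Q h - ?H Q K)
        + (measure_pmf.expectation Q h - ?H Q K)"
    by (intro tendsto_intros conv h_lim)
  moreover have "norm (?S Q K - ?S Q K) + (measure_pmf.expectation Q h - ?H Q K)
        + (measure_pmf.expectation Q h - ?H Q K) < e"
    using K by simp
  ultimately have "\<forall>\<^sub>F m in sequentially. norm (?S (P m) K - ?S Q K)
      + (measure_pmf.expectation (P m) h - ?H (P m) K) + (measure_pmf.expectation Q h - ?H Q K) < e"
    by (rule order_tendstoD)
  then show "\<forall>\<^sub>F m in sequentially. dist (measure_pmf.expectation (P m) g) (measure_pmf.expectation Q g) < e"
  proof eventually_elim
    case (elim m)
    have "dist (measure_pmf.expectation (P m) g) (measure_pmf.expectation Q g)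
      = norm ((?S (P m) K - ?S Q K) + (measure_pmf.expectation (P m) g - ?S (P m) K)
          - (measure_pmf.expectation Q g - ?S Q K))"
      by (simp add: dist_norm)
    also have "\<dots> \<le> norm (?S (P m) K - ?S Q K) + norm (measure_pmf.expectation (P m) g - ?S (P m) K)
        + norm (measure_pmf.expectation Q g - ?S Q K)"
      by (intro norm_triangle_le_diff norm_triangle_ineq add_right_mono order_refl)
    also have "\<dots> < e"
      using elim norm_expectation_diff_partial_sum_le[OF hP[of m] gh, of K]
        norm_expectation_diff_partial_sum_le[OF hQ gh, of K] by linarith
    finally show ?case .
  qed
qed

text \<open>A Fatou argument: some partial sum of the divergent series exceeds \<open>B\<close>, its
  finitely many terms pass to the limit, and the remaining terms are nonnegative.\<close>

lemma expectation_at_top_if_nn_integral_infinite: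
  fixes f :: "nat \<Rightarrow> real"
  assumes conv: "\<And>k. (\<lambda>m. pmf (P m) k) \<longlonglongrightarrow> pmf Q k"
    and int: "\<And>m. integrable (measure_pmf (P m)) f" and nonneg: "\<And>k. f k \<ge> 0"
    and infinite: "(\<integral>\<^sup>+ k. ennreal (f k) \<partial>measure_pmf Q) = \<infinity>"
  shows "filterlim (\<lambda>m. measure_pmf.expectation (P m) f) at_top sequentially"
  unfolding filterlim_at_top_dense
proof
  fix B :: real
  have "\<not> summable (\<lambda>k. pmf Q k * f k)"
  proof
    assume "summable (\<lambda>k. pmf Q k * f k)"
    then have "(\<Sum>k. ennreal (pmf Q k * f k)) \<noteq> top"
      using nonneg by (intro ennreal_suminf_neq_top) auto
    moreover have "(\<integral>\<^sup>+ k. ennreal (f k) \<partial>measure_pmf Q) = (\<Sum>k. ennreal (pmf Q k * f k))"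
      using nonneg by (simp add: nn_integral_measure_pmf nn_integral_count_space_nat ennreal_mult)
    ultimately show False using infinite by simp
  qed
  then obtain K where K: "(\<Sum>k<K. pmf Q k * f k) > B"
    using summableI_nonneg_bounded[of "\<lambda>k. pmf Q k * f k" B] nonneg
    by (metis mult_nonneg_nonneg not_le pmf_nonneg)
  have "(\<lambda>m. \<Sum>k<K. pmf (P m) k * f k) \<longlonglongrightarrow> (\<Sum>k<K. pmf Q k * f k)"
    by (intro tendsto_intros conv)
  from order_tendstoD(1)[OF this K]
  show "\<forall>\<^sub>F m in sequentially. B < measure_pmf.expectation (P m) f"
  proof eventually_elim
    case (elim m)
    \<comment> \<open>The tail estimate with \<open>g = h = f\<close> shows that the discarded tail
      is nonnegative.\<close>
    have "0 \<le> norm (measure_pmf.expectation (P m) f - (\<Sum>k<K. pmf (P m) k * f k))"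
      by simp
    also have "\<dots> \<le> measure_pmf.expectation (P m) f - (\<Sum>k<K. pmf (P m) k * f k)"
      using norm_expectation_diff_partial_sum_le[OF int[of m], of f K] nonneg by simp
    finally show ?case using elim by linarith
  qed
qed

section \<open>Compound Poisson sums\<close>

lemma real_le_square: "real z \<le> real z ^ 2"
  by (cases z) (auto simp: power2_eq_square)

lemma integrable_real_if_square:
  assumes "integrable (measure_pmf q) (\<lambda>z. real z ^ 2)"
  shows "integrable (measure_pmf q) real"
proof (rule Bochner_Integration.integrable_bound[OF assms])
  show "AE z in measure_pmf q. norm (real z) \<le> norm (real z ^ 2)"
    using real_le_square by simp
qed simp

text \<open>As a density followed by a shift, the law becomes accessible to change of variables, for
  integrands with values in any Banach space.\<close>

lemma measure_size_biased_pmf: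
  assumes int: "integrable (measure_pmf Q) real" and pos: "measure_pmf.expectation Q real > 0"
  shows "measure_pmf (size_biased_pmf Q) =
    distr (density (measure_pmf Q) (\<lambda>z. ennreal (real z / measure_pmf.expectation Q real)))
      (count_space UNIV) (\<lambda>z. z - 1)" (is "_ = distr (density _ ?d) _ _")
proof (rule measure_eqI_countable[where A=UNIV])
  fix j :: nat
  have "emeasure (distr (density (measure_pmf Q) ?d) (count_space UNIV) (\<lambda>z. z - 1)) {j}
      = (\<integral>\<^sup>+ z. ?d z * indicator {z. z - 1 = j} z \<partial>measure_pmf Q)"
    by (simp add: emeasure_distr emeasure_density vimage_def)
  \<comment> \<open>For \<open>j = 0\<close> truncated subtraction also admits \<open>z = 0\<close>,
    but the density vanishes there.\<close>
  also have "\<dots> = (\<integral>\<^sup>+ z. ?d (Suc j) * indicator {Suc j} z \<partial>measure_pmf Q)"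
    by (intro nn_integral_cong) (auto simp: indicator_def)
  also have "\<dots> = ennreal (real (Suc j) / measure_pmf.expectation Q real * pmf Q (Suc j))"
    using pos by (simp add: nn_integral_cmult emeasure_pmf_single flip: ennreal_mult)
  also have "\<dots> = emeasure (measure_pmf (size_biased_pmf Q)) {j}"
    using pmf_size_biased_pmf[OF assms] by (simp add: emeasure_pmf_single mult_ac)
  finally show "emeasure (measure_pmf (size_biased_pmf Q)) {j} =
      emeasure (distr (density (measure_pmf Q) ?d) (count_space UNIV) (\<lambda>z. z - 1)) {j}" ..
qed auto

lemma size_biased_pmf_expectation:
  fixes g :: "nat \<Rightarrow> 'b::{banach, second_countable_topology}"
  assumes int: "integrable (measure_pmf Q) real" and pos: "measure_pmf.expectation Q real > 0"
    and g: "integrable (measure_pmf Q) (\<lambda>z. real z *\<^sub>R g (z - 1))"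
  shows "integrable (measure_pmf (size_biased_pmf Q)) g"
    and "measure_pmf.expectation (size_biased_pmf Q) g =
      measure_pmf.expectation Q (\<lambda>z. real z *\<^sub>R g (z - 1)) /\<^sub>R measure_pmf.expectation Q real"
proof -
  let ?E = "measure_pmf.expectation Q real"
  have eq: "(\<lambda>z. (real z / ?E) *\<^sub>R g (z - 1)) = (\<lambda>z. inverse ?E *\<^sub>R (real z *\<^sub>R g (z - 1)))"
    by (simp add: divide_inverse mult.commute)
  show "integrable (measure_pmf (size_biased_pmf Q)) g"
    unfolding measure_size_biased_pmf[OF int pos]
    using pos g by (simp add: integrable_distr_eq integrable_density eq del: One_nat_def scaleR_scaleR)
  show "measure_pmf.expectation (size_biased_pmf Q) g =
      measure_pmf.expectation Q (\<lambda>z. real z *\<^sub>R g (z - 1)) /\<^sub>R ?E"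
    unfolding measure_size_biased_pmf[OF int pos]
    using pos by (simp add: integral_distr integral_density eq del: One_nat_def scaleR_scaleR)
qed

text \<open>The generating function and the first two factorial moments, kept as series because
  conditioning on the number of summands produces series. The moments follow by index shift:
  \<open>k\<close> times the weight at \<open>k\<close> is \<open>r\<close> times the weight at
  \<open>k - 1\<close>.\<close>

lemma poisson_pmf_sums:
  assumes r: "r > 0"
  shows poisson_pmf_exp_sums: "(\<lambda>k. pmf (poisson_pmf r) k *\<^sub>R z ^ k) sums exp (of_real r * (z - 1 :: complex))"
    and poisson_pmf_mean_sums: "(\<lambda>k. pmf (poisson_pmf r) k * real k) sums r"
    and poisson_pmf_second_sums: "(\<lambda>k. pmf (poisson_pmf r) k * (real k * (real k - 1))) sums r\<^sup>2"
proof -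
  have e: "(\<lambda>k. r ^ k / fact k * exp (- r)) sums 1"
    using sums_mult2[OF exp_converges[of r], of "exp (- r)"]
    by (simp add: exp_minus divide_inverse mult_ac)
  have "(\<lambda>k. exp (- of_real r) * ((of_real r * z) ^ k /\<^sub>R fact k)) sums (exp (- of_real r) * exp (of_real r * z))"
    by (intro sums_mult exp_converges)
  moreover have "exp (- of_real r) * ((of_real r * z) ^ k /\<^sub>R fact k) = pmf (poisson_pmf r) k *\<^sub>R z ^ k" for k
    using r by (simp add: scaleR_conv_of_real power_mult_distrib divide_inverse exp_of_real exp_minus)
  ultimately show "(\<lambda>k. pmf (poisson_pmf r) k *\<^sub>R z ^ k) sums exp (of_real r * (z - 1))"
    by (simp add: algebra_simps flip: exp_add)
  have mean: "pmf (poisson_pmf r) (Suc k) * real (Suc k) = r * (r ^ k / fact k * exp (- r))" for k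
    using r by (simp add: field_simps del: of_nat_Suc)
  show 1: "(\<lambda>k. pmf (poisson_pmf r) k * real k) sums r"
    using sums_mult[OF e, of r] unfolding mean[symmetric] by (subst (asm) sums_Suc_iff) simp
  have second: "pmf (poisson_pmf r) (Suc k) * (real (Suc k) * (real (Suc k) - 1)) = r * (pmf (poisson_pmf r) k * real k)" for k
    unfolding mult.assoc[symmetric] mean using r by simp
  show "(\<lambda>k. pmf (poisson_pmf r) k * (real k * (real k - 1))) sums r\<^sup>2"
    using sums_mult[OF 1, of r] unfolding second[symmetric]
    by (subst (asm) sums_Suc_iff) (simp add: power2_eq_square)
qed

lemma norm_falling_2: "norm (real k * (real k - 1)) = real k * (real k - 1)"
  by (cases k) auto

section \<open>Sums of a Poisson number of independent terms\<close>

locale compound_poisson = prob_space +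
  fixes N :: "'a \<Rightarrow> nat" and Y :: "nat \<Rightarrow> 'a \<Rightarrow> nat" and q :: "nat pmf" and r :: real
  assumes indep: "indep_vars (\<lambda>_. count_space UNIV) (\<lambda>i. if i = 0 then N else Y i) {0..}"
    and distr_Y: "\<And>j. j \<ge> 1 \<Longrightarrow> distr M (count_space UNIV) (Y j) = measure_pmf q"
    and r_pos: "r > 0"
    and distr_N: "distr M (count_space UNIV) N = measure_pmf (poisson_pmf r)"
begin

definition S :: "nat \<Rightarrow> 'a \<Rightarrow> nat" where "S k \<omega> = (\<Sum>j = 1..k. Y j \<omega>)"

lemma S_0 [simp]: "S 0 \<omega> = 0" and S_Suc [simp]: "S (Suc k) \<omega> = S k \<omega> + Y (Suc k) \<omega>"
  by (simp_all add: S_def)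

lemma measurable_N [measurable]: "N \<in> measurable M (count_space UNIV)"
  using indep by (auto simp: indep_vars_def split: if_splits)

lemma measurable_Y: "j \<ge> 1 \<Longrightarrow> Y j \<in> measurable M (count_space UNIV)"
  using indep by (auto simp: indep_vars_def dest: spec[of _ j])

lemma measurable_S [measurable]: "S k \<in> measurable M (count_space UNIV)"
proof (induction k)
  case (Suc k)
  note [measurable] = Suc measurable_Y[of "Suc k", simplified]
  show ?case by simp
qed simp

lemma measurable_S_N [measurable]: "(\<lambda>\<omega>. S (N \<omega>) \<omega>) \<in> measurable M (count_space UNIV)"
  by (rule measurable_compose_countable[OF _ measurable_N]) simp

text \<open>The two variables depend on the disjoint coordinate blocks \<open>{0}\<close> and
  \<open>{1..k}\<close> of one independent family.\<close>

lemma indep_N_S: "indep_var (count_space UNIV) N (count_space UNIV) (S k)"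
proof -
  have "indep_var (count_space UNIV) ((\<lambda>f. f 0) \<circ> (\<lambda>\<omega>. restrict (\<lambda>i. (if i = 0 then N else Y i) \<omega>) {0}))
      (count_space UNIV) ((\<lambda>f. \<Sum>j = 1..k. f j) \<circ> (\<lambda>\<omega>. restrict (\<lambda>i. (if i = 0 then N else Y i) \<omega>) {1..k}))"
    by (rule indep_var_compose[OF indep_var_restrict[OF indep]]) auto
  also have "(\<lambda>f. f 0) \<circ> (\<lambda>\<omega>. restrict (\<lambda>i. (if i = 0 then N else Y i) \<omega>) {0}) = N"
    by auto
  also have "(\<lambda>f. \<Sum>j = 1..k. f j) \<circ> (\<lambda>\<omega>. restrict (\<lambda>i. (if i = 0 then N else Y i) \<omega>) {1..k}) = S k"
    by (auto simp: fun_eq_iff S_def intro!: sum.cong)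
  finally show ?thesis .
qed

lemma indep_S_Y: "indep_var (count_space UNIV) (S k) (count_space UNIV) (Y (Suc k))"
proof -
  have "indep_var (count_space UNIV) ((\<lambda>f. \<Sum>j = 1..k. f j) \<circ> (\<lambda>\<omega>. restrict (\<lambda>i. (if i = 0 then N else Y i) \<omega>) {1..k}))
      (count_space UNIV) ((\<lambda>f. f (Suc k)) \<circ> (\<lambda>\<omega>. restrict (\<lambda>i. (if i = 0 then N else Y i) \<omega>) {Suc k}))"
    by (rule indep_var_compose[OF indep_var_restrict[OF indep]]) auto
  also have "(\<lambda>f. f (Suc k)) \<circ> (\<lambda>\<omega>. restrict (\<lambda>i. (if i = 0 then N else Y i) \<omega>) {Suc k}) = Y (Suc k)"
    by auto
  also have "(\<lambda>f. \<Sum>j = 1..k. f j) \<circ> (\<lambda>\<omega>. restrict (\<lambda>i. (if i = 0 then N else Y i) \<omega>) {1..k}) = S k"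
    by (auto simp: fun_eq_iff S_def intro!: sum.cong)
  finally show ?thesis .
qed

lemma expectation_Y:
  fixes g :: "nat \<Rightarrow> 'b::{banach, second_countable_topology}"
  assumes "j \<ge> 1"
  shows "integrable M (\<lambda>\<omega>. g (Y j \<omega>)) \<longleftrightarrow> integrable (measure_pmf q) g"
    and "(\<integral>\<omega>. g (Y j \<omega>) \<partial>M) = measure_pmf.expectation q g"
  using distr_Y[OF assms] measurable_Y[OF assms]
  by (auto simp flip: integral_distr[of _ M "count_space UNIV"] integrable_distr_eq[of _ M "count_space UNIV"])

lemma prob_N: "prob {\<omega> \<in> space M. N \<omega> = k} = pmf (poisson_pmf r) k"
proof -
  have "prob {\<omega> \<in> space M. N \<omega> = k} = measure (distr M (count_space UNIV) N) {k}"
    by (subst measure_distr) (auto intro!: arg_cong[where f=prob])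
  then show ?thesis
    by (simp add: distr_N measure_pmf_single)
qed

lemma integrable_of_bool_N:
  "integrable M (\<lambda>\<omega>. of_bool (N \<omega> = k) :: 'b :: {real_normed_field, banach, second_countable_topology})"
  by (rule integrable_const_bound[of _ 1]) auto

lemma expectation_of_bool_N:
  "(\<integral>\<omega>. of_bool (N \<omega> = k) \<partial>M) =
    (of_real (pmf (poisson_pmf r) k) :: 'b :: {real_normed_field, banach, second_countable_topology})"
proof -
  have "(\<integral>\<omega>. of_bool (N \<omega> = k) \<partial>M) = (\<integral>\<omega>. (of_real (indicator {\<omega> \<in> space M. N \<omega> = k} \<omega>) :: 'b) \<partial>M)"
    by (intro Bochner_Integration.integral_cong) auto
  also have "\<dots> = of_real (\<integral>\<omega>. indicator {\<omega> \<in> space M. N \<omega> = k} \<omega> \<partial>M)"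
    by (intro integral_of_real integrable_real_indicator) (auto simp: emeasure_eq_measure)
  also have "\<dots> = of_real (prob {\<omega> \<in> space M. N \<omega> = k})"
    by simp
  finally show ?thesis by (simp add: prob_N)
qed

lemma expectation_product:
  fixes f g :: "nat \<Rightarrow> 'b::{real_normed_field, banach, second_countable_topology}"
  assumes ind: "indep_var (count_space UNIV) A (count_space UNIV) B"
    and "integrable M (\<lambda>\<omega>. f (A \<omega>))" "integrable M (\<lambda>\<omega>. g (B \<omega>))"
  shows "integrable M (\<lambda>\<omega>. f (A \<omega>) * g (B \<omega>))"
    and "(\<integral>\<omega>. f (A \<omega>) * g (B \<omega>) \<partial>M) = (\<integral>\<omega>. f (A \<omega>) \<partial>M) * (\<integral>\<omega>. g (B \<omega>) \<partial>M)"
proof -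
  have "indep_var borel (f \<circ> A) borel (g \<circ> B)"
    by (rule indep_var_compose[OF ind]) auto
  then show "integrable M (\<lambda>\<omega>. f (A \<omega>) * g (B \<omega>))"
    and "(\<integral>\<omega>. f (A \<omega>) * g (B \<omega>) \<partial>M) = (\<integral>\<omega>. f (A \<omega>) \<partial>M) * (\<integral>\<omega>. g (B \<omega>) \<partial>M)"
    using indep_var_integrable[of "f \<circ> A" "g \<circ> B"] indep_var_lebesgue_integral[of "f \<circ> A" "g \<circ> B"] assms
    by (simp_all add: o_def)
qed

text \<open>Conditioning on the number of terms: \<open>F (S (N \<omega>) \<omega>)\<close> is a
  series over \<open>k\<close> with one possibly nonzero term, and independence of \<open>N\<close>
  and \<open>S k\<close> factors each expectation. The hypothesis \<open>summable\<close> permits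
  exchanging sum and integral.\<close>

lemma expectation_S_N_sums:
  fixes F :: "nat \<Rightarrow> 'b::{real_normed_field, banach, second_countable_topology}"
  assumes int: "\<And>k. integrable M (\<lambda>\<omega>. F (S k \<omega>))"
    and summable: "summable (\<lambda>k. pmf (poisson_pmf r) k * (\<integral>\<omega>. norm (F (S k \<omega>)) \<partial>M))"
  shows "(\<lambda>k. pmf (poisson_pmf r) k *\<^sub>R (\<integral>\<omega>. F (S k \<omega>) \<partial>M)) sums (\<integral>\<omega>. F (S (N \<omega>) \<omega>) \<partial>M)"
proof -
  have "(\<lambda>k. \<integral>\<omega>. of_bool (N \<omega> = k) * F (S k \<omega>) \<partial>M) sums (\<integral>\<omega>. (\<Sum>k. of_bool (N \<omega> = k) * F (S k \<omega>)) \<partial>M)"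
  proof (rule sums_integral)
    show "integrable M (\<lambda>\<omega>. of_bool (N \<omega> = k) * F (S k \<omega>))" for k
      by (rule expectation_product(1)[OF indep_N_S[of k], of "\<lambda>x. of_bool (x = k)" F, OF integrable_of_bool_N int])
    show "AE \<omega> in M. summable (\<lambda>k. norm (of_bool (N \<omega> = k) * F (S k \<omega>)))"
    proof (rule AE_I2)
      fix \<omega>
      show "summable (\<lambda>k. norm (of_bool (N \<omega> = k) * F (S k \<omega>)))"
        by (rule summable_finite[of "{N \<omega>}"]) auto
    qed
    have "(\<integral>\<omega>. norm (of_bool (N \<omega> = k) * F (S k \<omega>)) \<partial>M) = pmf (poisson_pmf r) k * (\<integral>\<omega>. norm (F (S k \<omega>)) \<partial>M)" for k
    proof -
      have "(\<integral>\<omega>. norm (of_bool (N \<omega> = k) * F (S k \<omega>)) \<partial>M) = (\<integral>\<omega>. of_bool (N \<omega> = k) * norm (F (S k \<omega>)) \<partial>M)"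
        by (intro Bochner_Integration.integral_cong) (auto simp: norm_mult)
      also have "\<dots> = pmf (poisson_pmf r) k * (\<integral>\<omega>. norm (F (S k \<omega>)) \<partial>M)"
        using expectation_product(2)[OF indep_N_S[of k], of "\<lambda>x. of_bool (x = k)" "\<lambda>x. norm (F x)",
            OF integrable_of_bool_N integrable_norm[OF int]]
        by (simp add: expectation_of_bool_N)
      finally show ?thesis .
    qed
    then show "summable (\<lambda>k. \<integral>\<omega>. norm (of_bool (N \<omega> = k) * F (S k \<omega>)) \<partial>M)"
      using summable by simp
  qed
  moreover have "(\<Sum>k. of_bool (N \<omega> = k) * F (S k \<omega>)) = F (S (N \<omega>) \<omega>)" for \<omega>
    by (subst suminf_finite[of "{N \<omega>}"]) auto
  moreover have "(\<integral>\<omega>. of_bool (N \<omega> = k) * F (S k \<omega>) \<partial>M) = pmf (poisson_pmf r) k *\<^sub>R (\<integral>\<omega>. F (S k \<omega>) \<partial>M)" for k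
    using expectation_product(2)[OF indep_N_S[of k], of "\<lambda>x. of_bool (x = k)" F, OF integrable_of_bool_N int]
    by (simp add: expectation_of_bool_N scaleR_conv_of_real)
  ultimately show ?thesis by simp
qed

text \<open>The characteristic function of \<open>S k\<close> is the \<open>k\<close>-th power of
  that of \<open>q\<close>; averaging over \<open>k\<close> evaluates the Poisson generating
  function at it.\<close>

lemma char_compound_poisson:
  "char (distr M borel (\<lambda>\<omega>. real (S (N \<omega>) \<omega>))) t =
    exp (of_real r * (measure_pmf.expectation q (\<lambda>z. iexp (t * real z)) - 1))"
proof -
  let ?\<phi> = "measure_pmf.expectation q (\<lambda>z. iexp (t * real z))"
  have int: "integrable M (\<lambda>\<omega>. iexp (t * real (S k \<omega>)))" for k
    by (rule integrable_const_bound[of _ 1]) (auto simp: norm_exp_eq_Re)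
  have intY: "integrable M (\<lambda>\<omega>. iexp (t * real (Y (Suc k) \<omega>)))" for k
    by (rule integrable_const_bound[of _ 1]) (use measurable_Y[of "Suc k"] in \<open>auto simp: norm_exp_eq_Re\<close>)
  have pow: "(\<integral>\<omega>. iexp (t * real (S k \<omega>)) \<partial>M) = ?\<phi> ^ k" for k
  proof (induction k)
    case 0
    then show ?case by (simp add: prob_space)
  next
    case (Suc k)
    have "(\<integral>\<omega>. iexp (t * real (S (Suc k) \<omega>)) \<partial>M) =
        (\<integral>\<omega>. iexp (t * real (S k \<omega>)) * iexp (t * real (Y (Suc k) \<omega>)) \<partial>M)"
      by (simp add: algebra_simps flip: exp_add)
    also have "\<dots> = ?\<phi> ^ k * ?\<phi>"
      using expectation_product(2)[OF indep_S_Y[of k], of "\<lambda>x. iexp (t * real x)" "\<lambda>x. iexp (t * real x)"]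
        int intY Suc expectation_Y(2)[of "Suc k" "\<lambda>x. iexp (t * real x)"] by simp
    finally show ?case by simp
  qed
  \<comment> \<open>The integrands have modulus one, so only summability of the Poisson weights is
    needed: the generating function at 1.\<close>
  have "summable (\<lambda>k. complex_of_real (pmf (poisson_pmf r) k))"
    using sums_summable[OF poisson_pmf_exp_sums[OF r_pos, of 1]] by (simp add: scaleR_conv_of_real)
  then have "summable (\<lambda>k. pmf (poisson_pmf r) k * (\<integral>\<omega>. norm (iexp (t * real (S k \<omega>))) \<partial>M))"
    by (simp add: prob_space summable_complex_of_real del: pmf_poisson)
  from expectation_S_N_sums[OF int this]
  have "(\<lambda>k. pmf (poisson_pmf r) k *\<^sub>R ?\<phi> ^ k) sums (\<integral>\<omega>. iexp (t * real (S (N \<omega>) \<omega>)) \<partial>M)"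
    unfolding pow .
  from sums_unique2[OF this poisson_pmf_exp_sums[OF r_pos]] show ?thesis
    unfolding char_def by (subst integral_distr) auto
qed

text \<open>Falling factorials obey a binomial rule,
  \<open>(x + y)_2 = (x)_2 + 2 x y + (y)_2\<close>. The induction carries all four claims together
  because the second moment of \<open>S (Suc k)\<close> needs the mean and integrability of
  \<open>S k\<close>.\<close>

lemma moments_S:
  assumes int: "integrable (measure_pmf q) (\<lambda>z. real z ^ 2)"
  defines "e1 \<equiv> measure_pmf.expectation q real"
    and "e2 \<equiv> measure_pmf.expectation q (\<lambda>z. real z * (real z - 1))"
  shows "integrable M (\<lambda>\<omega>. real (S k \<omega>))" "(\<integral>\<omega>. real (S k \<omega>) \<partial>M) = real k * e1"
    "integrable M (\<lambda>\<omega>. real (S k \<omega>) * (real (S k \<omega>) - 1))"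
    "(\<integral>\<omega>. real (S k \<omega>) * (real (S k \<omega>) - 1) \<partial>M) = real k * e2 + real k * (real k - 1) * e1\<^sup>2"
proof -
  have q1: "integrable (measure_pmf q) real"
    by (rule integrable_real_if_square[OF int])
  have q2: "integrable (measure_pmf q) (\<lambda>z. real z * (real z - 1))"
    using Bochner_Integration.integrable_diff[OF int q1] by (simp add: algebra_simps power2_eq_square)
  have "integrable M (\<lambda>\<omega>. real (S k \<omega>)) \<and> (\<integral>\<omega>. real (S k \<omega>) \<partial>M) = real k * e1
    \<and> integrable M (\<lambda>\<omega>. real (S k \<omega>) * (real (S k \<omega>) - 1))
    \<and> (\<integral>\<omega>. real (S k \<omega>) * (real (S k \<omega>) - 1) \<partial>M) = real k * e2 + real k * (real k - 1) * e1\<^sup>2"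
  proof (induction k)
    case (Suc k)
    have Y1: "integrable M (\<lambda>\<omega>. real (Y (Suc k) \<omega>))" "(\<integral>\<omega>. real (Y (Suc k) \<omega>) \<partial>M) = e1"
      using expectation_Y[of "Suc k" real] q1 by (auto simp: e1_def)
    have Y2: "integrable M (\<lambda>\<omega>. real (Y (Suc k) \<omega>) * (real (Y (Suc k) \<omega>) - 1))"
      "(\<integral>\<omega>. real (Y (Suc k) \<omega>) * (real (Y (Suc k) \<omega>) - 1) \<partial>M) = e2"
      using expectation_Y[of "Suc k" "\<lambda>z. real z * (real z - 1)"] q2 by (auto simp: e2_def)
    have XY: "integrable M (\<lambda>\<omega>. real (S k \<omega>) * real (Y (Suc k) \<omega>))"
      "(\<integral>\<omega>. real (S k \<omega>) * real (Y (Suc k) \<omega>) \<partial>M) = real k * e1 * e1"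
      using expectation_product[OF indep_S_Y[of k], of real real] Suc Y1 by auto
    have eq1: "real (S (Suc k) \<omega>) = real (S k \<omega>) + real (Y (Suc k) \<omega>)" for \<omega> by simp
    have eq2: "real (S (Suc k) \<omega>) * (real (S (Suc k) \<omega>) - 1)
      = real (S k \<omega>) * (real (S k \<omega>) - 1) + 2 * (real (S k \<omega>) * real (Y (Suc k) \<omega>))
        + real (Y (Suc k) \<omega>) * (real (Y (Suc k) \<omega>) - 1)" for \<omega>
      unfolding eq1 by (simp only: algebra_simps)
    have "real k * e2 + real k * (real k - 1) * e1\<^sup>2 + 2 * (real k * e1 * e1) + e2
        = real (Suc k) * e2 + real (Suc k) * (real (Suc k) - 1) * e1\<^sup>2"
      by (simp add: power2_eq_square algebra_simps)
    with Suc Y1 Y2 XY show ?case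
      unfolding eq2 unfolding eq1 by (simp add: distrib_right[of _ 1 e1] del: of_nat_Suc) (simp add: algebra_simps)
  qed simp
  then show "integrable M (\<lambda>\<omega>. real (S k \<omega>))" "(\<integral>\<omega>. real (S k \<omega>) \<partial>M) = real k * e1"
    "integrable M (\<lambda>\<omega>. real (S k \<omega>) * (real (S k \<omega>) - 1))"
    "(\<integral>\<omega>. real (S k \<omega>) * (real (S k \<omega>) - 1) \<partial>M) = real k * e2 + real k * (real k - 1) * e1\<^sup>2"
    by blast+
qed

text \<open>The second factorial moment exceeds the squared mean by \<open>r * e2\<close>; this
  difference is the numerator of the limit in case (a).\<close>

lemma moments_compound_poisson:
  assumes int: "integrable (measure_pmf q) (\<lambda>z. real z ^ 2)"
  defines "e1 \<equiv> measure_pmf.expectation q real"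
    and "e2 \<equiv> measure_pmf.expectation q (\<lambda>z. real z * (real z - 1))"
  shows "(\<integral>\<omega>. real (S (N \<omega>) \<omega>) \<partial>M) = r * e1"
    and "(\<integral>\<omega>. real (S (N \<omega>) \<omega>) * (real (S (N \<omega>) \<omega>) - 1) \<partial>M) = r * e2 + r\<^sup>2 * e1\<^sup>2"
proof -
  note moments = moments_S[OF int, folded e1_def e2_def]
  have s1: "(\<lambda>k. pmf (poisson_pmf r) k * (real k * e1)) sums (r * e1)"
    using sums_mult2[OF poisson_pmf_mean_sums[OF r_pos], of e1] by (simp add: mult.assoc)
  have s2: "(\<lambda>k. pmf (poisson_pmf r) k * (real k * e2 + real k * (real k - 1) * e1\<^sup>2)) sums (r * e2 + r\<^sup>2 * e1\<^sup>2)"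
    using sums_add[OF sums_mult2[OF poisson_pmf_mean_sums[OF r_pos], of e2] sums_mult2[OF poisson_pmf_second_sums[OF r_pos], of "e1\<^sup>2"]]
    by (simp add: algebra_simps)
  have "(\<lambda>k. pmf (poisson_pmf r) k * (real k * e1)) sums (\<integral>\<omega>. real (S (N \<omega>) \<omega>) \<partial>M)"
    using expectation_S_N_sums[of real] moments sums_summable[OF s1] by simp
  then show "(\<integral>\<omega>. real (S (N \<omega>) \<omega>) \<partial>M) = r * e1"
    using s1 sums_unique2 by blast
  have "(\<lambda>k. pmf (poisson_pmf r) k * (real k * e2 + real k * (real k - 1) * e1\<^sup>2))
      sums (\<integral>\<omega>. real (S (N \<omega>) \<omega>) * (real (S (N \<omega>) \<omega>) - 1) \<partial>M)"
    using expectation_S_N_sums[of "\<lambda>x. real x * (real x - 1)", OF moments(3)] sums_summable[OF s2]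
    unfolding norm_falling_2 moments(4) real_scaleR_def by blast
  then show "(\<integral>\<omega>. real (S (N \<omega>) \<omega>) * (real (S (N \<omega>) \<omega>) - 1) \<partial>M) = r * e2 + r\<^sup>2 * e1\<^sup>2"
    using s2 sums_unique2 by blast
qed

end

section \<open>Degrees and triangles in the passive random intersection graph\<close>

lemma card_supersets:
  assumes "finite X" "S \<subseteq> X"
  shows "card {A. S \<subseteq> A \<and> A \<subseteq> X \<and> card A = k} =
    (if card S \<le> k then (card X - card S) choose (k - card S) else 0)"
proof (cases "card S \<le> k")
  case True
  have fin: "finite S" using assms finite_subset by blast
  have "bij_betw (\<lambda>A. A - S) {A. S \<subseteq> A \<and> A \<subseteq> X \<and> card A = k} {B. B \<subseteq> X - S \<and> card B = k - card S}"
    by (rule bij_betwI[where g="\<lambda>B. B \<union> S"])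
      (use assms fin True in \<open>auto simp: card_Diff_subset card_Un_disjoint finite_subset Int_Diff
        intro!: card_Un_disjoint[THEN trans] dest: finite_subset\<close>)
  then have "card {A. S \<subseteq> A \<and> A \<subseteq> X \<and> card A = k} = card {B. B \<subseteq> X - S \<and> card B = k - card S}"
    by (rule bij_betw_same_card)
  also have "\<dots> = (card X - card S) choose (k - card S)"
    using assms fin by (simp add: n_subsets card_Diff_subset)
  finally show ?thesis using True by simp
next
  case False
  have "{A. S \<subseteq> A \<and> A \<subseteq> X \<and> card A = k} = {}"
    using False assms by (auto dest: card_mono finite_subset)
  then show ?thesis using False by (metis (no_types, lifting) card.empty)
qed

lemma set_random_subset_pmf:
  assumes "set_pmf P \<subseteq> {0..m}" "A \<in> set_pmf (random_subset_pmf m P)"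
  shows "A \<subseteq> {1..m}"
proof -
  obtain k where k: "k \<in> set_pmf P" "A \<in> set_pmf (pmf_of_set {A. A \<subseteq> {1..m} \<and> card A = k})"
    using assms(2) by (auto simp: random_subset_pmf_def)
  have "finite {A. A \<subseteq> {1..m} \<and> card A = k}"
    by (rule finite_subset[of _ "Pow {1..m}"]) auto
  moreover have "{A. A \<subseteq> {1..m} \<and> card A = k} \<noteq> {}"
    using k assms(1) by (auto intro!: exI[of _ "{1..k}"])
  ultimately show ?thesis using k(2) by simp
qed

text \<open>Among the \<open>k\<close>-subsets, the share containing \<open>S\<close> is
  \<open>(k choose s) / (m choose s)\<close> with \<open>s = card S\<close>, which separates
  \<open>k\<close> from \<open>m\<close>. The weight \<open>g\<close> serves the characteristic
  function, where \<open>S = {1}\<close>; the constant weight 1 gives containment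
  probabilities.\<close>

lemma expectation_random_subset_superset:
  fixes g :: "nat \<Rightarrow> 'b::{banach, second_countable_topology}"
  assumes P: "set_pmf P \<subseteq> {0..m}" and S: "S \<subseteq> {1..m}"
  shows "measure_pmf.expectation (random_subset_pmf m P) (\<lambda>D. if S \<subseteq> D then g (card D) else 0) =
    measure_pmf.expectation P (\<lambda>k. (real (k choose card S) / real (m choose card S)) *\<^sub>R g k)"
proof -
  let ?F = "\<lambda>k. {A. A \<subseteq> {1..m} \<and> card A = k}"
  let ?h = "\<lambda>D. if S \<subseteq> D then g (card D) else 0"
  have fin: "finite (?F k)" for k
    by (rule finite_subset[of _ "Pow {1..m}"]) auto
  have ne: "?F k \<noteq> {}" if "k \<le> m" for k
    using that by (auto intro!: exI[of _ "{1..k}"])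
  have cardF: "card (?F k) = m choose k" for k
    using n_subsets[of "{1..m}" k] by simp
  have S_le: "card S \<le> m" using card_mono[OF _ S] by simp
  have inner: "(\<Sum>D\<in>?F k. ?h D /\<^sub>R real (card (?F k))) = (real (k choose card S) / real (m choose card S)) *\<^sub>R g k"
    if "k \<le> m" for k
  proof -
    have "(\<Sum>D\<in>?F k. ?h D /\<^sub>R real (card (?F k)))
        = (\<Sum>D\<in>?F k. if S \<subseteq> D then g k /\<^sub>R real (m choose k) else 0)"
      unfolding cardF by (intro sum.cong) auto
    also have "\<dots> = (\<Sum>D\<in>{D\<in>?F k. S \<subseteq> D}. g k /\<^sub>R real (m choose k))"
      by (rule sum.inter_filter[OF fin, symmetric])
    also have "{D\<in>?F k. S \<subseteq> D} = {A. S \<subseteq> A \<and> A \<subseteq> {1..m} \<and> card A = k}"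
      by auto
    also have "(\<Sum>D\<in>\<dots>. g k /\<^sub>R real (m choose k)) = (real (card \<dots>) / real (m choose k)) *\<^sub>R g k"
      by (simp add: scaleR_conv_of_real sum_constant_scaleR divide_inverse)
    also have "real (card {A. S \<subseteq> A \<and> A \<subseteq> {1..m} \<and> card A = k}) / real (m choose k)
        = real (k choose card S) / real (m choose card S)"
    proof (cases "card S \<le> k")
      case True
      have "real (m choose k) * real (k choose card S) = real (m choose card S) * real ((m - card S) choose (k - card S))"
        using choose_mult[OF True that] by (simp flip: of_nat_mult)
      moreover have "real (m choose k) > 0" "real (m choose card S) > 0"
        using that S_le by simp_all
      ultimately show ?thesis
        using True card_supersets[OF _ S, of k] by (simp add: field_simps)
    next
      case False
      then show ?thesis by (subst card_supersets[OF _ S]) simp_all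
    qed
    finally show ?thesis .
  qed
  have "measure_pmf.expectation (random_subset_pmf m P) ?h
      = (\<Sum>k\<in>{0..m}. pmf P k *\<^sub>R (\<Sum>D\<in>?F k. ?h D /\<^sub>R real (card (?F k))))"
    unfolding random_subset_pmf_def
  proof (subst pmf_expectation_bind[OF _ _ P])
    show "(\<Sum>k\<in>{0..m}. pmf P k *\<^sub>R measure_pmf.expectation (pmf_of_set (?F k)) ?h)
        = (\<Sum>k\<in>{0..m}. pmf P k *\<^sub>R (\<Sum>D\<in>?F k. ?h D /\<^sub>R real (card (?F k))))"
    proof (intro sum.cong arg_cong2[where f=scaleR] refl)
      fix k assume "k \<in> {0..m}"
      then have "k \<le> m" by simp
      show "measure_pmf.expectation (pmf_of_set (?F k)) ?h = (\<Sum>D\<in>?F k. ?h D /\<^sub>R real (card (?F k)))"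
        by (subst integral_measure_pmf[OF fin[of k]])
          (use fin[of k] ne[OF \<open>k \<le> m\<close>] in \<open>auto intro!: sum.cong simp: pmf_of_set divide_inverse\<close>)
    qed
  qed (use fin ne in auto)
  also have "\<dots> = (\<Sum>k\<in>{0..m}. pmf P k *\<^sub>R ((real (k choose card S) / real (m choose card S)) *\<^sub>R g k))"
    by (intro sum.cong arg_cong2[where f=scaleR] refl inner) simp
  also have "\<dots> = measure_pmf.expectation P (\<lambda>k. (real (k choose card S) / real (m choose card S)) *\<^sub>R g k)"
    by (rule integral_measure_pmf[symmetric]) (use P in auto)
  finally show ?thesis .
qed

text \<open>The probability that one random subset contains \<open>s\<close> prescribed vertices,
  encoded as a binomial moment so that its asymptotics follow from the moments of
  \<open>P\<close>.\<close>

definition superset_prob :: "nat \<Rightarrow> nat pmf \<Rightarrow> nat \<Rightarrow> real" where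
  "superset_prob m P s = measure_pmf.expectation P (\<lambda>k. real (k choose s)) / real (m choose s)"

lemma prob_eq_expectation_of_bool:
  "measure_pmf.prob p {x. A x} = measure_pmf.expectation p (\<lambda>x. of_bool (A x))"
proof -
  have "(\<lambda>x. of_bool (A x)) = (indicator {x. A x} :: _ \<Rightarrow> real)"
    by auto
  then show ?thesis by simp
qed

lemma integrable_of_bool_pmf [simp]: "integrable (measure_pmf p) (\<lambda>x. of_bool (A x) :: real)"
  by (rule measure_pmf.integrable_const_bound[of _ 1]) auto

lemma prob_random_subset_superset:
  assumes "set_pmf P \<subseteq> {0..m}" "S \<subseteq> {1..m}"
  shows "measure_pmf.prob (random_subset_pmf m P) {D. S \<subseteq> D} = superset_prob m P (card S)"
  using expectation_random_subset_superset[OF assms, of "\<lambda>_. 1 :: real"]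
  by (simp add: prob_eq_expectation_of_bool superset_prob_def of_bool_def)

lemma prob_not_not:
  "measure_pmf.prob p {x. \<not> A x \<and> \<not> B x} =
    1 - measure_pmf.prob p {x. A x} - measure_pmf.prob p {x. B x} + measure_pmf.prob p {x. A x \<and> B x}"
proof -
  have "measure_pmf.prob p {x. \<not> A x \<and> \<not> B x} = measure_pmf.expectation p
      (\<lambda>x. 1 - of_bool (A x) - of_bool (B x) + of_bool (A x \<and> B x))"
    unfolding prob_eq_expectation_of_bool by (intro Bochner_Integration.integral_cong) auto
  then show ?thesis by (simp add: prob_eq_expectation_of_bool del: of_bool_conj)
qed

lemma prob_not_not_not:
  "measure_pmf.prob p {x. \<not> A x \<and> \<not> B x \<and> \<not> C x} =
    1 - measure_pmf.prob p {x. A x} - measure_pmf.prob p {x. B x} - measure_pmf.prob p {x. C x}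
    + measure_pmf.prob p {x. A x \<and> B x} + measure_pmf.prob p {x. A x \<and> C x} + measure_pmf.prob p {x. B x \<and> C x}
    - measure_pmf.prob p {x. A x \<and> B x \<and> C x}"
proof -
  have "measure_pmf.prob p {x. \<not> A x \<and> \<not> B x \<and> \<not> C x} = measure_pmf.expectation p
      (\<lambda>x. 1 - of_bool (A x) - of_bool (B x) - of_bool (C x) + of_bool (A x \<and> B x) + of_bool (A x \<and> C x)
        + of_bool (B x \<and> C x) - of_bool (A x \<and> B x \<and> C x))"
    unfolding prob_eq_expectation_of_bool by (intro Bochner_Integration.integral_cong) auto
  then show ?thesis by (simp add: prob_eq_expectation_of_bool del: of_bool_conj)
qed

text \<open>An event that restricts every \<open>D j\<close> separately is a product event; this is
  why the graph events below are expressed through their complements.\<close>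

lemma prob_intersection_sample_all:
  "measure_pmf.prob (intersection_sample_pmf n m P) {D. \<forall>j\<in>{1..n}. A (D j)} =
    measure_pmf.prob (random_subset_pmf m P) {D. A D} ^ n"
proof -
  have "{D. \<forall>j\<in>{1..n}. A (D j)} = Pi {1..n} (\<lambda>_. {D. A D})"
    by auto
  then show ?thesis
    unfolding intersection_sample_pmf_def by (simp add: measure_Pi_pmf_Pi)
qed

section \<open>Exact path and triangle probabilities on three vertices\<close>

locale passive_graph =
  fixes n m :: nat and P :: "nat pmf"
  assumes P: "set_pmf P \<subseteq> {0..m}" and m: "m \<ge> 3"
begin

abbreviation "sample \<equiv> intersection_sample_pmf n m P"
abbreviation "u \<equiv> superset_prob m P 2"
abbreviation "v \<equiv> superset_prob m P 3"

lemma prob_pair: "x \<in> {1..m} \<Longrightarrow> y \<in> {1..m} \<Longrightarrow> x \<noteq> y \<Longrightarrow>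
    measure_pmf.prob (random_subset_pmf m P) {D. x \<in> D \<and> y \<in> D} = u"
  using prob_random_subset_superset[OF P, of "{x, y}"] by (simp add: card_insert_if numeral_2_eq_2)

lemma prob_triple: "measure_pmf.prob (random_subset_pmf m P) {D. 1 \<in> D \<and> 2 \<in> D \<and> 3 \<in> D} = v"
  using prob_random_subset_superset[OF P, of "{1, 2, 3}"] m by (simp add: numeral_3_eq_3)

lemmas prob_pairs = prob_pair[of 1 2] prob_pair[of 1 3] prob_pair[of 2 3]

lemma prob_avoid_pair:
  assumes "x \<in> {1..m}" "y \<in> {1..m}" "x \<noteq> y"
  shows "measure_pmf.prob (random_subset_pmf m P) {D. \<not> (x \<in> D \<and> y \<in> D)} = 1 - u"
  using prob_not_not[of "random_subset_pmf m P" "\<lambda>D. x \<in> D \<and> y \<in> D" "\<lambda>D. x \<in> D \<and> y \<in> D"] prob_pair[OF assms]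
  by simp

text \<open>Two pairs with a common vertex lie in \<open>D\<close> exactly when all three vertices
  do, whence \<open>v\<close>. The roles of the vertices are left free because the triangle formula
  needs each of them as the common one.\<close>

lemma prob_avoid_two_pairs:
  assumes "distinct [x, y, z]" "{x, y, z} = {1, 2, 3}"
  shows "measure_pmf.prob (random_subset_pmf m P) {D. \<not> (x \<in> D \<and> y \<in> D) \<and> \<not> (x \<in> D \<and> z \<in> D)} = 1 - 2 * u + v"
proof -
  have *: "x \<in> {1, 2, 3}" "y \<in> {1, 2, 3}" "z \<in> {1, 2, 3}" using assms(2) by blast+
  have "{D. (x \<in> D \<and> y \<in> D) \<and> (x \<in> D \<and> z \<in> D)} = {D. {x, y, z} \<subseteq> D}"
    by auto
  also have "\<dots> = {D. 1 \<in> D \<and> 2 \<in> D \<and> 3 \<in> D}"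
    unfolding assms(2) by auto
  finally have **: "measure_pmf.prob (random_subset_pmf m P) {D. (x \<in> D \<and> y \<in> D) \<and> (x \<in> D \<and> z \<in> D)} = v"
    using prob_triple by simp
  show ?thesis
    unfolding prob_not_not ** using prob_pair[of x y] prob_pair[of x z] * assms m
    by auto
qed

text \<open>Any two of the three pairs already force all three vertices, so inclusion-exclusion
  gives \<open>1 - 3 * u + 3 * v - v\<close>.\<close>

lemma prob_avoid_three_pairs:
  "measure_pmf.prob (random_subset_pmf m P)
    {D. \<not> (1 \<in> D \<and> 2 \<in> D) \<and> \<not> (1 \<in> D \<and> 3 \<in> D) \<and> \<not> (2 \<in> D \<and> 3 \<in> D)} = 1 - 3 * u + 2 * v"
proof -
  have "{D. (1 \<in> D \<and> 2 \<in> D) \<and> (1 \<in> D \<and> 3 \<in> D)} = {D. 1 \<in> D \<and> 2 \<in> D \<and> (3::nat) \<in> D}"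
    "{D. (1 \<in> D \<and> 2 \<in> D) \<and> (2 \<in> D \<and> 3 \<in> D)} = {D. 1 \<in> D \<and> 2 \<in> D \<and> (3::nat) \<in> D}"
    "{D. (1 \<in> D \<and> 3 \<in> D) \<and> (2 \<in> D \<and> 3 \<in> D)} = {D. 1 \<in> D \<and> 2 \<in> D \<and> (3::nat) \<in> D}"
    "{D. (1 \<in> D \<and> 2 \<in> D) \<and> (1 \<in> D \<and> 3 \<in> D) \<and> (2 \<in> D \<and> 3 \<in> D)} = {D. 1 \<in> D \<and> 2 \<in> D \<and> (3::nat) \<in> D}"
    by auto
  then show ?thesis
    unfolding prob_not_not_not using prob_triple prob_pairs m by simp
qed

text \<open>The last bound says that avoiding all three pairs has nonnegative probability. Together
  the bounds place \<open>u\<close>, \<open>2 * u - v\<close> and \<open>3 * u - 2 * v\<close> in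
  the unit interval.\<close>

lemma superset_prob_bounds: "0 \<le> v" "v \<le> u" "3 * u - 2 * v \<le> 1"
proof -
  show "0 \<le> v" unfolding prob_triple[symmetric] by simp
  have "v \<le> measure_pmf.prob (random_subset_pmf m P) {D. 1 \<in> D \<and> 2 \<in> D}"
    unfolding prob_triple[symmetric] by (intro measure_pmf.finite_measure_mono) auto
  then show "v \<le> u" using prob_pairs(1) m by simp
  have "0 \<le> 1 - 3 * u + 2 * v" unfolding prob_avoid_three_pairs[symmetric] by simp
  then show "3 * u - 2 * v \<le> 1" by simp
qed

text \<open>Unlike adjacency, this is a condition on each \<open>D j\<close> alone, so conjunctions
  of it have probabilities that are \<open>n\<close>-th powers.\<close>

definition nonadjacent :: "nat \<Rightarrow> nat \<Rightarrow> (nat \<Rightarrow> nat set) \<Rightarrow> bool" where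
  "nonadjacent x y D \<longleftrightarrow> (\<forall>j\<in>{1..n}. \<not> (x \<in> D j \<and> y \<in> D j))"

lemma passive_adj_iff: "x \<noteq> y \<Longrightarrow> passive_adj n D x y \<longleftrightarrow> \<not> nonadjacent x y D"
  by (auto simp: passive_adj_def nonadjacent_def)

lemma prob_nonadjacent:
  assumes "x \<in> {1..m}" "y \<in> {1..m}" "x \<noteq> y"
  shows "measure_pmf.prob sample {D. nonadjacent x y D} = (1 - u) ^ n"
  unfolding nonadjacent_def using prob_intersection_sample_all[where A="\<lambda>D. \<not> (x \<in> D \<and> y \<in> D)"]
    prob_avoid_pair[OF assms] by simp

lemma prob_nonadjacent_two:
  assumes "distinct [x, y, z]" "{x, y, z} = {1, 2, 3}"
  shows "measure_pmf.prob sample {D. nonadjacent x y D \<and> nonadjacent x z D} = (1 - 2 * u + v) ^ n"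
proof -
  have "{D. nonadjacent x y D \<and> nonadjacent x z D} =
      {D. \<forall>j\<in>{1..n}. \<not> (x \<in> D j \<and> y \<in> D j) \<and> \<not> (x \<in> D j \<and> z \<in> D j)}"
    unfolding nonadjacent_def by blast
  then show ?thesis
    using prob_intersection_sample_all[where A="\<lambda>D. \<not> (x \<in> D \<and> y \<in> D) \<and> \<not> (x \<in> D \<and> z \<in> D)"]
      prob_avoid_two_pairs[OF assms] by simp
qed

lemma prob_nonadjacent_three:
  "measure_pmf.prob sample {D. nonadjacent 1 2 D \<and> nonadjacent 1 3 D \<and> nonadjacent 2 3 D} = (1 - 3 * u + 2 * v) ^ n"
proof -
  have "{D. nonadjacent 1 2 D \<and> nonadjacent 1 3 D \<and> nonadjacent 2 3 D} =
      {D. \<forall>j\<in>{1..n}. \<not> (1 \<in> D j \<and> 2 \<in> D j) \<and> \<not> (1 \<in> D j \<and> 3 \<in> D j) \<and> \<not> (2 \<in> D j \<and> 3 \<in> D j)}"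
    unfolding nonadjacent_def by blast
  then show ?thesis
    using prob_intersection_sample_all[where A="\<lambda>D. \<not> (1 \<in> D \<and> 2 \<in> D) \<and> \<not> (1 \<in> D \<and> 3 \<in> D) \<and> \<not> (2 \<in> D \<and> 3 \<in> D)"]
      prob_avoid_three_pairs by simp
qed

lemma prob_path:
  "measure_pmf.prob sample {D. passive_adj n D 1 2 \<and> passive_adj n D 1 3} = 1 - 2 * (1 - u) ^ n + (1 - 2 * u + v) ^ n"
  using prob_not_not[of sample "nonadjacent 1 2" "nonadjacent 1 3"]
    prob_nonadjacent[of 1 2] prob_nonadjacent[of 1 3] prob_nonadjacent_two[of 1 2 3] m
  by (simp add: passive_adj_iff)

lemma prob_triangle:
  "measure_pmf.prob sample {D. passive_adj n D 2 3 \<and> passive_adj n D 1 2 \<and> passive_adj n D 1 3} =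
    1 - 3 * (1 - u) ^ n + 3 * (1 - 2 * u + v) ^ n - (1 - 3 * u + 2 * v) ^ n"
proof -
  have sym: "nonadjacent y x = nonadjacent x y" for x y by (auto simp: nonadjacent_def fun_eq_iff)
  \<comment> \<open>Each pair of conditions is reordered so that the shared vertex comes first, as
    \<open>prob_nonadjacent_two\<close> requires.\<close>
  have "{D. nonadjacent 1 3 D \<and> nonadjacent 2 3 D} = {D. nonadjacent 3 1 D \<and> nonadjacent 3 2 D}"
    "{D. nonadjacent 1 2 D \<and> nonadjacent 2 3 D} = {D. nonadjacent 2 1 D \<and> nonadjacent 2 3 D}"
    using sym by auto
  moreover have "{D. passive_adj n D 2 3 \<and> passive_adj n D 1 2 \<and> passive_adj n D 1 3} =
      {D. \<not> nonadjacent 1 2 D \<and> \<not> nonadjacent 1 3 D \<and> \<not> nonadjacent 2 3 D}"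
    by (auto simp: passive_adj_iff)
  ultimately show ?thesis
    using prob_nonadjacent_three prob_nonadjacent[of 1 2] prob_nonadjacent[of 1 3] prob_nonadjacent[of 2 3] m
      prob_nonadjacent_two[of 1 2 3] prob_nonadjacent_two[of 2 1 3] prob_nonadjacent_two[of 3 1 2]
    by (simp add: insert_commute prob_not_not_not)
qed

lemma clustering_coeff_eq:
  "clustering_coeff n m P =
    (1 - 3 * (1 - u) ^ n + 3 * (1 - 2 * u + v) ^ n - (1 - 3 * u + 2 * v) ^ n) /
    (1 - 2 * (1 - u) ^ n + (1 - 2 * u + v) ^ n)"
  unfolding clustering_coeff_def cond_prob_def using prob_path prob_triangle by simp

section \<open>The degree of vertex 1 compared with a sum of independent terms\<close>

text \<open>\<open>degree_sum\<close> overcounts the degree of vertex 1 exactly when two of the sets containing 1 share another element.\<close>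

definition degree_sum :: "(nat \<Rightarrow> nat set) \<Rightarrow> nat" where
  "degree_sum D = (\<Sum>j = 1..n. if 1 \<in> D j then card (D j) - 1 else 0)"

lemma passive_degree_eq_degree_sum:
  assumes sub: "\<And>j. j \<in> {1..n} \<Longrightarrow> D j \<subseteq> {1..m}"
    and disj: "\<And>i j w. i \<in> {1..n} \<Longrightarrow> j \<in> {1..n} \<Longrightarrow> i \<noteq> j \<Longrightarrow> w \<in> {2..m} \<Longrightarrow>
      \<not> ((1 \<in> D i \<and> w \<in> D i) \<and> (1 \<in> D j \<and> w \<in> D j))"
  shows "passive_degree n m D 1 = degree_sum D"
proof -
  let ?I = "{j\<in>{1..n}. 1 \<in> D j}"
  have "{w' \<in> {1..m}. passive_adj n D 1 w'} = (\<Union>j\<in>?I. D j - {1})"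
    unfolding passive_adj_def using sub by fastforce
  moreover have "card (\<Union>j\<in>?I. D j - {1}) = (\<Sum>j\<in>?I. card (D j - {1}))"
  proof (rule card_UN_disjoint)
    show "\<forall>j\<in>?I. finite (D j - {1})"
      using sub finite_subset by blast
    show "\<forall>i\<in>?I. \<forall>j\<in>?I. i \<noteq> j \<longrightarrow> (D i - {1}) \<inter> (D j - {1}) = {}"
    proof (intro ballI impI equals0I)
      fix i j w assume *: "i \<in> ?I" "j \<in> ?I" "i \<noteq> j" "w \<in> (D i - {1}) \<inter> (D j - {1})"
      then have "w \<in> {2..m}"
        using sub[of i] by force
      with disj[of i j w] * show False by auto
    qed
  qed simp
  moreover have "(\<Sum>j\<in>?I. card (D j - {1})) = degree_sum D"
    unfolding degree_sum_def sum.inter_filter[OF finite_atLeastAtMost]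
    by (intro sum.cong) auto
  ultimately show ?thesis
    unfolding passive_degree_def by simp
qed

text \<open>A union bound over two indices \<open>i\<close>, \<open>j\<close> and a second common
  vertex \<open>w\<close>: at most \<open>n^2 * m\<close> events, each of probability
  \<open>u^2\<close> because \<open>D i\<close> and \<open>D j\<close> are independent. Once
  \<open>n * m * u\<close> is bounded, this is of order \<open>1 / m\<close>.\<close>

lemma prob_degree_sum_ne:
  "measure_pmf.prob sample {D. passive_degree n m D 1 \<noteq> degree_sum D} \<le> real n ^ 2 * real m * u\<^sup>2"
proof -
  let ?E = "\<lambda>(i, j, w). {D. (1 \<in> D i \<and> w \<in> D i) \<and> (1 \<in> D j \<and> w \<in> D j)} :: (nat \<Rightarrow> nat set) set"
  let ?T = "{(i, j, w). i \<in> {1..n} \<and> j \<in> {1..n} \<and> i \<noteq> j \<and> w \<in> {2..m}}"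
  have T: "?T \<subseteq> {1..n} \<times> {1..n} \<times> {2..m}" by auto
  have finT: "finite ?T" by (rule finite_subset[OF T]) simp
  have "card ?T \<le> n * (n * (m - 1))"
    using card_mono[OF _ T] by (simp add: card_cartesian_product)
  also have "\<dots> \<le> n\<^sup>2 * m"
    by (simp add: power2_eq_square)
  finally have "real (card ?T) \<le> real (n\<^sup>2 * m)"
    by (rule of_nat_mono)
  then have cardT: "real (card ?T) \<le> real n ^ 2 * real m"
    by simp
  have E: "measure_pmf.prob sample (?E t) = u\<^sup>2" if "t \<in> ?T" for t
  proof -
    obtain i j w where t: "t = (i, j, w)" "i \<in> {1..n}" "j \<in> {1..n}" "i \<noteq> j" "w \<in> {2..m}"
      using \<open>t \<in> ?T\<close> by auto
    \<comment> \<open>Only coordinates \<open>i\<close> and \<open>j\<close> are constrained;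
      \<open>UNIV\<close> contributes a factor 1 elsewhere.\<close>
    let ?B = "\<lambda>k. if k \<in> {i, j} then {D. 1 \<in> D \<and> w \<in> D} else UNIV"
    have "?E t = Pi {1..n} ?B"
      using t by (auto simp: Pi_def split: if_splits)
    then have "measure_pmf.prob sample (?E t) = (\<Prod>k\<in>{1..n}. measure_pmf.prob (random_subset_pmf m P) (?B k))"
      unfolding intersection_sample_pmf_def by (simp only: measure_Pi_pmf_Pi finite_atLeastAtMost)
    also have "\<dots> = (\<Prod>k\<in>{i, j}. measure_pmf.prob (random_subset_pmf m P) (?B k))"
      by (rule prod.mono_neutral_right) (use t in auto)
    also have "\<dots> = u\<^sup>2"
      using t prob_pair[of 1 w] m by (simp add: power2_eq_square)
    finally show ?thesis .
  qed
  have "measure_pmf.prob sample {D. passive_degree n m D 1 \<noteq> degree_sum D} \<le> measure_pmf.prob sample (\<Union>t\<in>?T. ?E t)"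
  proof (rule measure_pmf.finite_measure_mono_AE)
    show "AE D in measure_pmf sample. D \<in> {D. passive_degree n m D 1 \<noteq> degree_sum D} \<longrightarrow> D \<in> (\<Union>t\<in>?T. ?E t)"
      unfolding AE_measure_pmf_iff
    proof (intro ballI impI)
      fix D assume D: "D \<in> set_pmf sample" and ne: "D \<in> {D. passive_degree n m D 1 \<noteq> degree_sum D}"
      have sub: "D j \<subseteq> {1..m}" if "j \<in> {1..n}" for j
      proof -
        have "D j \<in> set_pmf (random_subset_pmf m P)"
          using D that by (auto simp: intersection_sample_pmf_def set_Pi_pmf PiE_dflt_def)
        then show ?thesis by (rule set_random_subset_pmf[OF P])
      qed
      show "D \<in> (\<Union>t\<in>?T. ?E t)"
      proof (rule ccontr)
        assume "D \<notin> (\<Union>t\<in>?T. ?E t)"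
        then have "passive_degree n m D 1 = degree_sum D"
          by (intro passive_degree_eq_degree_sum[OF sub]) auto
        with ne show False by simp
      qed
    qed
  qed auto
  also have "\<dots> \<le> (\<Sum>t\<in>?T. measure_pmf.prob sample (?E t))"
    by (rule measure_pmf.finite_measure_subadditive_finite[OF finT]) auto
  also have "\<dots> = real (card ?T) * u\<^sup>2"
    using E by simp
  also have "\<dots> \<le> real n ^ 2 * real m * u\<^sup>2"
    by (intro mult_right_mono cardT) simp
  finally show ?thesis .
qed

text \<open>The summands are independent and identically distributed, and each vanishes unless
  vertex 1 lies in its set. Writing \<open>iexp\<close> as 1 minus a deviation supported on that
  event brings out the factor \<open>1 / m\<close>.\<close>

lemma char_degree_sum:
  "char (distr (measure_pmf sample) borel (\<lambda>D. real (degree_sum D))) t =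
    (1 - measure_pmf.expectation P (\<lambda>k. real k *\<^sub>R (1 - iexp (t * real (k - 1)))) / of_nat m) ^ n"
proof -
  let ?f = "\<lambda>D. real (if 1 \<in> D then card D - 1 else 0)"
  have ind: "prob_space.indep_vars (measure_pmf sample) (\<lambda>_. borel) (\<lambda>j D. ?f (D j)) {1..n}"
    unfolding intersection_sample_pmf_def
    by (rule prob_space.indep_vars_compose2[OF measure_pmf.prob_space_axioms indep_vars_Pi_pmf]) auto
  have single: "char (distr (measure_pmf sample) borel (\<lambda>D. ?f (D j))) t =
      1 - measure_pmf.expectation P (\<lambda>k. real k *\<^sub>R (1 - iexp (t * real (k - 1)))) / of_nat m"
    if "j \<in> {1..n}" for j
  proof -
    let ?R = "random_subset_pmf m P"
    let ?g = "\<lambda>k. 1 - iexp (t * real (k - 1))"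
    have int: "integrable (measure_pmf ?R) (\<lambda>D. if {1} \<subseteq> D then ?g (card D) else 0)"
      by (rule measure_pmf.integrable_const_bound[of _ 2])
        (auto intro!: AE_I2 norm_triangle_ineq4[THEN order_trans] simp: norm_exp_eq_Re)
    have "char (distr (measure_pmf sample) borel (\<lambda>D. ?f (D j))) t
        = measure_pmf.expectation (map_pmf (\<lambda>D. D j) sample) (\<lambda>D. iexp (t * ?f D))"
      unfolding char_def by (subst integral_distr) auto
    also have "map_pmf (\<lambda>D. D j) sample = ?R"
      using that by (simp add: intersection_sample_pmf_def Pi_pmf_component)
    also have "measure_pmf.expectation ?R (\<lambda>D. iexp (t * ?f D))
        = measure_pmf.expectation ?R (\<lambda>D. 1 - (if {1} \<subseteq> D then ?g (card D) else 0))"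
      by (intro Bochner_Integration.integral_cong) auto
    also have "\<dots> = 1 - measure_pmf.expectation ?R (\<lambda>D. if {1} \<subseteq> D then ?g (card D) else 0)"
      by (subst Bochner_Integration.integral_diff[OF _ int]) auto
    also have "measure_pmf.expectation ?R (\<lambda>D. if {1} \<subseteq> D then ?g (card D) else 0)
        = measure_pmf.expectation P (\<lambda>k. (real k / real m) *\<^sub>R ?g k)"
      using expectation_random_subset_superset[OF P, of "{1}" ?g] m by simp
    also have "\<dots> = measure_pmf.expectation P (\<lambda>k. (real k *\<^sub>R ?g k) / of_nat m)"
      by (intro Bochner_Integration.integral_cong) (auto simp: scaleR_conv_of_real)
    also have "\<dots> = measure_pmf.expectation P (\<lambda>k. real k *\<^sub>R ?g k) / of_nat m"
      by (rule Bochner_Integration.integral_divide_zero)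
    finally show ?thesis .
  qed
  have "(\<lambda>D. real (degree_sum D)) = (\<lambda>D. \<Sum>j = 1..n. ?f (D j))"
    by (auto simp: degree_sum_def fun_eq_iff intro!: sum.cong)
  then show ?thesis
    using prob_space.char_distr_sum[OF measure_pmf.prob_space_axioms ind, of t] single by simp
qed

text \<open>The two exponentials agree off the exceptional event and differ by at most 2 on
  it.\<close>

lemma norm_char_degree_diff_le:
  "norm (char (distr (measure_pmf sample) borel (\<lambda>D. real (passive_degree n m D 1))) t
      - char (distr (measure_pmf sample) borel (\<lambda>D. real (degree_sum D))) t)
    \<le> 2 * (real n ^ 2 * real m * u\<^sup>2)"
proof -
  let ?h = "\<lambda>D. iexp (t * real (passive_degree n m D 1)) - iexp (t * real (degree_sum D))"
  have int: "integrable (measure_pmf sample) (\<lambda>D. iexp (t * real (X D)))" for X :: "(nat \<Rightarrow> nat set) \<Rightarrow> nat"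
    by (rule measure_pmf.integrable_const_bound[of _ 1]) auto
  have ch: "char (distr (measure_pmf sample) borel (\<lambda>D. real (X D))) t =
      measure_pmf.expectation sample (\<lambda>D. iexp (t * real (X D)))" for X :: "(nat \<Rightarrow> nat set) \<Rightarrow> nat"
    unfolding char_def by (subst integral_distr) auto
  have "norm (char (distr (measure_pmf sample) borel (\<lambda>D. real (passive_degree n m D 1))) t
      - char (distr (measure_pmf sample) borel (\<lambda>D. real (degree_sum D))) t)
      = norm (measure_pmf.expectation sample ?h)"
    unfolding ch by (simp only: Bochner_Integration.integral_diff[OF int int])
  also have "\<dots> \<le> measure_pmf.expectation sample (\<lambda>D. norm (?h D))"
    by (rule integral_norm_bound)
  also have "\<dots> \<le> measure_pmf.expectation sample (\<lambda>D. 2 * of_bool (passive_degree n m D 1 \<noteq> degree_sum D))"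
  proof (rule integral_mono)
    show "integrable (measure_pmf sample) (\<lambda>D. norm (?h D))"
      by (intro integrable_norm Bochner_Integration.integrable_diff int)
    show "norm (?h D) \<le> 2 * of_bool (passive_degree n m D 1 \<noteq> degree_sum D)" for D
      using norm_triangle_ineq4[of "iexp (t * real (passive_degree n m D 1))" "iexp (t * real (degree_sum D))"]
      by auto
  qed (intro integrable_mult_right integrable_of_bool_pmf)
  also have "\<dots> = 2 * measure_pmf.prob sample {D. passive_degree n m D 1 \<noteq> degree_sum D}"
    by (simp add: prob_eq_expectation_of_bool)
  finally show ?thesis
    using prob_degree_sum_ne by linarith
qed

end

section \<open>Asymptotics\<close>

text \<open>Both \<open>1 - a m / m\<close> and \<open>exp (- a m / m)\<close> have modulus at most
  one, the latter by \<open>Re\<close>, so their \<open>n m\<close>-th powers differ by at most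
  \<open>n m\<close> times the difference of the bases. That difference is a first-order Taylor
  remainder of order \<open>1 / m^2\<close>, while \<open>n m\<close> is of order
  \<open>m\<close>.\<close>

lemma tendsto_power_exp_complex:
  fixes a :: "nat \<Rightarrow> complex" and n :: "nat \<Rightarrow> nat"
  assumes n: "(\<lambda>m. real (n m) / real m) \<longlonglongrightarrow> c"
    and a: "a \<longlonglongrightarrow> l" and Re: "\<And>m. Re (a m) \<ge> 0"
    and norm_le: "\<forall>\<^sub>F m in sequentially. norm (1 - a m / of_nat m) \<le> 1"
  shows "(\<lambda>m. (1 - a m / of_nat m) ^ n m) \<longlonglongrightarrow> exp (- of_real c * l)"
proof -
  let ?w = "\<lambda>m. - (a m / of_nat m)"
  have inv: "(\<lambda>m. 1 / real m) \<longlonglongrightarrow> 0"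
    by (rule lim_1_over_n)
  have w0: "?w \<longlonglongrightarrow> - (l * 0)"
    using tendsto_mult[OF a tendsto_of_real[OF inv]]
    by (intro tendsto_minus) (simp add: divide_inverse)
  have small: "\<forall>\<^sub>F m in sequentially. norm (?w m) < 1"
    using tendsto_norm[OF w0] by (intro order_tendstoD) auto
  have bound: "\<forall>\<^sub>F m in sequentially. norm ((1 - a m / of_nat m) ^ n m - exp (?w m) ^ n m)
      \<le> exp 1 * (real (n m) / real m * (1 / real m) * norm (a m) ^ 2)"
    using norm_le small
  proof eventually_elim
    case (elim m)
    have "Re (?w m) \<le> 0"
      using Re[of m] by (simp add: Re_divide_of_nat)
    then have "norm (exp (?w m)) \<le> 1"
      by simp
    then have "norm ((1 - a m / of_nat m) ^ n m - exp (?w m) ^ n m)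
        \<le> real (n m) * norm ((1 - a m / of_nat m) - exp (?w m))"
      using elim(1) by (rule norm_power_diff[rotated])
    also have "norm ((1 - a m / of_nat m) - exp (?w m)) = norm (exp (?w m) - (\<Sum>k\<le>1. ?w m ^ k / fact k))"
      by (simp add: norm_minus_commute)
    also have "\<dots> \<le> exp \<bar>Re (?w m)\<bar> * norm (?w m) ^ Suc 1 / fact 1"
      by (rule Taylor_exp)
    also have "\<dots> \<le> exp 1 * norm (?w m) ^ Suc 1 / fact 1"
      using elim(2) abs_Re_le_cmod[of "?w m"] by (intro divide_right_mono mult_right_mono) auto
    finally have "norm ((1 - a m / of_nat m) ^ n m - exp (?w m) ^ n m)
        \<le> real (n m) * (exp 1 * norm (?w m) ^ Suc 1 / fact 1)"
      by (simp add: mult_left_mono)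
    also have "\<dots> = exp 1 * (real (n m) / real m * (1 / real m) * norm (a m) ^ 2)"
      by (simp add: norm_divide power2_eq_square)
    finally show ?case .
  qed
  have "(\<lambda>m. exp 1 * (real (n m) / real m * (1 / real m) * norm (a m) ^ 2)) \<longlonglongrightarrow> exp 1 * (c * 0 * norm l ^ 2)"
    by (intro tendsto_intros n inv a)
  then have diff: "(\<lambda>m. (1 - a m / of_nat m) ^ n m - exp (?w m) ^ n m) \<longlonglongrightarrow> 0"
    by (intro Lim_null_comparison[OF bound]) simp
  have "(\<lambda>m. exp (- of_real (real (n m) / real m) * a m)) \<longlonglongrightarrow> exp (- of_real c * l)"
    by (intro tendsto_intros n a)
  moreover have "exp (- of_real (real (n m) / real m) * a m) = exp (?w m) ^ n m" for m
    unfolding exp_of_nat_mult[symmetric] by simp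
  ultimately have "(\<lambda>m. exp (?w m) ^ n m) \<longlonglongrightarrow> exp (- of_real c * l)"
    by simp
  from tendsto_add[OF diff this] show ?thesis
    by simp
qed

text \<open>The error bound is uniform in \<open>n\<close> and \<open>x\<close>, as needed when both
  vary with \<open>m\<close>. The induction multiplies a two-sided estimate by \<open>1 - x\<close>;
  the quadratic polynomial itself is an upper bound.\<close>

lemma power_one_minus_second_order:
  fixes x :: real
  assumes "0 \<le> x" "x \<le> 1"
  shows "\<bar>(1 - x) ^ n - (1 - real n * x + real n * (real n - 1) / 2 * x\<^sup>2)\<bar> \<le> real n ^ 3 * x ^ 3"
proof -
  have bern: "1 - real n * x \<le> (1 - x) ^ n" for n
    using Bernoulli_inequality[of "-x" n] assms by simp
  have "(1 - x) ^ n \<le> 1 - real n * x + real n * (real n - 1) / 2 * x\<^sup>2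
      \<and> 1 - real n * x + real n * (real n - 1) / 2 * x\<^sup>2 - real n ^ 3 * x ^ 3 \<le> (1 - x) ^ n"
  proof (induction n)
    case (Suc n)
    let ?p = "1 - real n * x + real n * (real n - 1) / 2 * x\<^sup>2"
    have falling: "0 \<le> real n * (real n - 1)" by (cases n) auto
    have "(1 - x) ^ Suc n \<le> (1 - x) * ?p"
      using Suc assms by (simp add: mult_left_mono)
    also have "\<dots> = 1 - real (Suc n) * x + real (Suc n) * (real (Suc n) - 1) / 2 * x\<^sup>2
        - real n * (real n - 1) / 2 * x ^ 3"
      by (simp add: field_simps power2_eq_square power3_eq_cube)
    also have "\<dots> \<le> 1 - real (Suc n) * x + real (Suc n) * (real (Suc n) - 1) / 2 * x\<^sup>2"
      using falling assms by simp
    finally have 1: "(1 - x) ^ Suc n \<le> 1 - real (Suc n) * x + real (Suc n) * (real (Suc n) - 1) / 2 * x\<^sup>2" .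
    \<comment> \<open>Multiplying the polynomial by \<open>1 - x\<close> leaves an extra cubic term,
      which the growth from \<open>n^3\<close> to \<open>(n + 1)^3\<close> absorbs.\<close>
    have "real n * (real n - 1) / 2 + real n ^ 3 \<le> real (Suc n) ^ 3"
      by (simp add: field_simps power2_eq_square power3_eq_cube)
    then have "(real n * (real n - 1) / 2 + real n ^ 3) * x ^ 3 \<le> real (Suc n) ^ 3 * x ^ 3"
      using assms by (intro mult_right_mono) auto
    then have "1 - real (Suc n) * x + real (Suc n) * (real (Suc n) - 1) / 2 * x\<^sup>2 - real (Suc n) ^ 3 * x ^ 3
        \<le> 1 - real (Suc n) * x + real (Suc n) * (real (Suc n) - 1) / 2 * x\<^sup>2
          - (real n * (real n - 1) / 2 + real n ^ 3) * x ^ 3"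
      by linarith
    also have "\<dots> = (1 - x) * ?p - real n ^ 3 * x ^ 3"
      by (simp add: field_simps power2_eq_square power3_eq_cube)
    also have "\<dots> \<le> (1 - x) * ?p - (1 - x) * (real n ^ 3 * x ^ 3)"
      using assms by (simp add: mult_left_le_one_le)
    also have "\<dots> = (1 - x) * (?p - real n ^ 3 * x ^ 3)"
      by (simp add: algebra_simps)
    also have "\<dots> \<le> (1 - x) ^ Suc n"
      using Suc assms by (simp add: mult_left_mono)
    finally show ?case using 1 by blast
  qed simp
  moreover have "0 \<le> real n ^ 3 * x ^ 3" using assms by simp
  ultimately show ?thesis unfolding abs_le_iff by linarith
qed

text \<open>
  The scaled numerator and denominator of the clustering coefficient differ from
  \<open>R = n m\<^sup>2 v\<close> and \<open>R + (n m u)\<^sup>2\<close> by relative errors \<open>o(1)\<close> in \<open>R\<close> and absolute errors \<open>o(1)\<close>.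
\<close>

lemma clustering_expansion:
  fixes u v :: real and n m :: nat
  assumes uv: "0 \<le> v" "v \<le> u" "3 * u - 2 * v \<le> 1"
  defines "y \<equiv> real n * real m * u" and "R \<equiv> real n * real m ^ 2 * v"
  shows "\<bar>real m ^ 2 * (1 - 3 * (1 - u) ^ n + 3 * (1 - 2 * u + v) ^ n - (1 - 3 * u + 2 * v) ^ n)
      - R * (1 - (real n - 1) / 2 * v)\<bar> \<le> 54 * (y ^ 3 / real m)" (is "\<bar>_ * ?A - _\<bar> \<le> _")
    and "\<bar>real m ^ 2 * (1 - 2 * (1 - u) ^ n + (1 - 2 * u + v) ^ n)
      - (R * (1 + (real n - 1) / 2 * (v - 4 * u)) + (y ^ 2 - y * (real m * u)))\<bar> \<le> 54 * (y ^ 3 / real m)"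
      (is "\<bar>_ * ?B - _\<bar> \<le> _")
proof -
  let ?b = "\<lambda>x. (1 - x) ^ n" and ?q = "\<lambda>x. 1 - real n * x + real n * (real n - 1) / 2 * x\<^sup>2"
  let ?c = "real n ^ 3 * u ^ 3"
  have u: "0 \<le> u" "u \<le> 1" using uv by auto
  have e1: "\<bar>?b u - ?q u\<bar> \<le> ?c"
    using power_one_minus_second_order[of u n] u by simp
  have "\<bar>?b (2 * u - v) - ?q (2 * u - v)\<bar> \<le> real n ^ 3 * (2 * u - v) ^ 3"
    by (rule power_one_minus_second_order) (use uv in auto)
  also have "\<dots> \<le> real n ^ 3 * (2 * u) ^ 3"
    using uv by (intro mult_left_mono power_mono) auto
  finally have e2: "\<bar>?b (2 * u - v) - ?q (2 * u - v)\<bar> \<le> 8 * ?c"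
    by (simp add: power_mult_distrib)
  have "\<bar>?b (3 * u - 2 * v) - ?q (3 * u - 2 * v)\<bar> \<le> real n ^ 3 * (3 * u - 2 * v) ^ 3"
    by (rule power_one_minus_second_order) (use uv in auto)
  also have "\<dots> \<le> real n ^ 3 * (3 * u) ^ 3"
    using uv by (intro mult_left_mono power_mono) auto
  finally have e3: "\<bar>?b (3 * u - 2 * v) - ?q (3 * u - 2 * v)\<bar> \<le> 27 * ?c"
    by (simp add: power_mult_distrib)
  \<comment> \<open>The constant is \<open>54 = 3 + 3 * 8 + 27\<close>, the factors 8 and 27 being
    the cubes from \<open>2 * u - v \<le> 2 * u\<close> and
    \<open>3 * u - 2 * v \<le> 3 * u\<close>. The denominator produces \<open>2 + 8\<close> and
    shares the constant.\<close>
  have comb3: "\<bar>1 - 3 * X1 + 3 * X2 - X3 - (1 - 3 * Y1 + 3 * Y2 - Y3)\<bar> \<le> 54 * c"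
    if "\<bar>X1 - Y1\<bar> \<le> c" "\<bar>X2 - Y2\<bar> \<le> 8 * c" "\<bar>X3 - Y3\<bar> \<le> 27 * c" for X1 X2 X3 Y1 Y2 Y3 c :: real
    using that by linarith
  have comb2: "\<bar>1 - 2 * X1 + X2 - (1 - 2 * Y1 + Y2)\<bar> \<le> 54 * c"
    if "\<bar>X1 - Y1\<bar> \<le> c" "\<bar>X2 - Y2\<bar> \<le> 8 * c" for X1 X2 Y1 Y2 c :: real
    using that by linarith
  have b: "(1 - 2 * u + v) ^ n = ?b (2 * u - v)" "(1 - 3 * u + 2 * v) ^ n = ?b (3 * u - 2 * v)"
    by (simp_all add: algebra_simps)
  have scaled: "real m ^ 2 * (54 * ?c) = 54 * (y ^ 3 / real m)"
    by (simp add: y_def power_mult_distrib power2_eq_square power3_eq_cube)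
  have abs_scaled: "\<bar>real m ^ 2 * X - real m ^ 2 * Y\<bar> \<le> 54 * (y ^ 3 / real m)" if "\<bar>X - Y\<bar> \<le> 54 * ?c" for X Y
    using mult_left_mono[OF that, of "real m ^ 2"]
    unfolding scaled right_diff_distrib[symmetric] abs_mult by simp
  have "\<bar>?A - (1 - 3 * ?q u + 3 * ?q (2 * u - v) - ?q (3 * u - 2 * v))\<bar> \<le> 54 * ?c"
    unfolding b by (rule comb3[OF e1 e2 e3])
  note abs_scaled[OF this]
  \<comment> \<open>The terms in \<open>u\<close>, \<open>u^2\<close> and \<open>u * v\<close> all
    cancel here, leaving \<open>n * v - n * (n - 1) / 2 * v^2\<close>.\<close>
  also have "real m ^ 2 * (1 - 3 * ?q u + 3 * ?q (2 * u - v) - ?q (3 * u - 2 * v)) = R * (1 - (real n - 1) / 2 * v)"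
    by (simp add: R_def field_simps power2_eq_square)
  finally show "\<bar>real m ^ 2 * ?A - R * (1 - (real n - 1) / 2 * v)\<bar> \<le> 54 * (y ^ 3 / real m)" .
  have "\<bar>?B - (1 - 2 * ?q u + ?q (2 * u - v))\<bar> \<le> 54 * ?c"
    unfolding b by (rule comb2[OF e1 e2])
  note abs_scaled[OF this]
  \<comment> \<open>Here a term \<open>n * (n - 1) * u^2\<close> survives: a path whose two edges
    come from different sets. Scaled by \<open>m^2\<close> it equals
    \<open>y^2 - y * (m * u)\<close>.\<close>
  also have "real m ^ 2 * (1 - 2 * ?q u + ?q (2 * u - v))
      = R * (1 + (real n - 1) / 2 * (v - 4 * u)) + (y ^ 2 - y * (real m * u))"
    by (simp add: R_def y_def field_simps power2_eq_square)
  finally show "\<bar>real m ^ 2 * ?B - (R * (1 + (real n - 1) / 2 * (v - 4 * u)) + (y ^ 2 - y * (real m * u)))\<bar>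
      \<le> 54 * (y ^ 3 / real m)" .
qed

text \<open>All errors vanish because \<open>n * u\<close>, \<open>m * u\<close> and
  \<open>y^3 / m\<close> tend to 0 when \<open>y = n * m * u\<close> converges. The errors
  \<open>d1\<close>, \<open>d2\<close> are relative to \<open>R\<close>, so they stay harmless even
  when \<open>R\<close> diverges.\<close>

lemma clustering_limit:
  fixes u v :: "nat \<Rightarrow> real" and n :: "nat \<Rightarrow> nat" and \<kappa> :: real
  assumes n: "filterlim n at_top sequentially"
    and uv: "\<forall>\<^sub>F m in sequentially. 0 \<le> v m \<and> v m \<le> u m \<and> 3 * u m - 2 * v m \<le> 1"
    and y: "(\<lambda>m. real (n m) * real m * u m) \<longlonglongrightarrow> \<kappa>"
  defines "R \<equiv> \<lambda>m. real (n m) * real m ^ 2 * v m"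
    and "A \<equiv> \<lambda>m. 1 - 3 * (1 - u m) ^ n m + 3 * (1 - 2 * u m + v m) ^ n m - (1 - 3 * u m + 2 * v m) ^ n m"
    and "B \<equiv> \<lambda>m. 1 - 2 * (1 - u m) ^ n m + (1 - 2 * u m + v m) ^ n m"
  shows clustering_limit_finite: "R \<longlonglongrightarrow> \<rho> \<Longrightarrow> \<rho> + \<kappa>\<^sup>2 \<noteq> 0 \<Longrightarrow> (\<lambda>m. A m / B m) \<longlonglongrightarrow> \<rho> / (\<rho> + \<kappa>\<^sup>2)"
    and clustering_limit_infinite: "filterlim R at_top sequentially \<Longrightarrow> (\<lambda>m. A m / B m) \<longlonglongrightarrow> 1"
proof -
  let ?y = "\<lambda>m. real (n m) * real m * u m"
  define d1 where "d1 m = - ((real (n m) - 1) / 2 * v m)" for m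
  define d2 where "d2 m = (real (n m) - 1) / 2 * (v m - 4 * u m)" for m
  define k where "k m = ?y m ^ 2 - ?y m * (real m * u m)" for m
  define e1 where "e1 m = real m ^ 2 * A m - R m * (1 + d1 m)" for m
  define e2 where "e2 m = real m ^ 2 * B m - (R m * (1 + d2 m) + k m)" for m
  have n1: "\<forall>\<^sub>F m in sequentially. n m \<ge> 1"
    using n by (auto simp: filterlim_at_top)
  have m1: "\<forall>\<^sub>F m :: nat in sequentially. m \<ge> 1"
    by (rule eventually_ge_at_top)
  have inv_n: "(\<lambda>m. 1 / real (n m)) \<longlonglongrightarrow> 0"
    using filterlim_compose[OF lim_1_over_n n] by simp
  have nu: "(\<lambda>m. real (n m) * u m) \<longlonglongrightarrow> 0"
  proof (rule Lim_transform_eventually)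
    show "(\<lambda>m. ?y m * (1 / real m)) \<longlonglongrightarrow> 0"
      using tendsto_mult[OF y lim_1_over_n] by simp
    show "\<forall>\<^sub>F m in sequentially. ?y m * (1 / real m) = real (n m) * u m"
      using m1 by eventually_elim simp
  qed
  have mu: "(\<lambda>m. real m * u m) \<longlonglongrightarrow> 0"
  proof (rule Lim_transform_eventually)
    show "(\<lambda>m. ?y m * (1 / real (n m))) \<longlonglongrightarrow> 0"
      using tendsto_mult[OF y inv_n] by simp
    show "\<forall>\<^sub>F m in sequentially. ?y m * (1 / real (n m)) = real m * u m"
      using n1 by eventually_elim simp
  qed
  have d1: "d1 \<longlonglongrightarrow> 0"
  proof (rule Lim_null_comparison[OF _ nu])
    show "\<forall>\<^sub>F m in sequentially. norm (d1 m) \<le> real (n m) * u m"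
      using uv n1
    proof eventually_elim
      case (elim m)
      have "\<bar>d1 m\<bar> = (real (n m) - 1) / 2 * v m"
        using elim by (simp add: d1_def abs_mult)
      also have "\<dots> \<le> real (n m) * u m"
        using elim by (intro mult_mono) auto
      finally show ?case by simp
    qed
  qed
  have d2: "d2 \<longlonglongrightarrow> 0"
  proof (rule Lim_null_comparison)
    show "(\<lambda>m. 4 * (real (n m) * u m)) \<longlonglongrightarrow> 0"
      using tendsto_mult_left[OF nu, of 4] by simp
    show "\<forall>\<^sub>F m in sequentially. norm (d2 m) \<le> 4 * (real (n m) * u m)"
      using uv n1
    proof eventually_elim
      case (elim m)
      have "\<bar>d2 m\<bar> = (real (n m) - 1) / 2 * (4 * u m - v m)"
        using elim by (simp add: d2_def abs_mult)
      also have "\<dots> \<le> real (n m) * (4 * u m)"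
        using elim by (intro mult_mono) auto
      finally show ?case by simp
    qed
  qed
  have k: "k \<longlonglongrightarrow> \<kappa>\<^sup>2"
    unfolding k_def using tendsto_diff[OF tendsto_power[OF y, of 2] tendsto_mult[OF y mu]] by simp
  have err: "(\<lambda>m. 54 * (?y m ^ 3 / real m)) \<longlonglongrightarrow> 0"
    using tendsto_mult[OF tendsto_const[of 54] tendsto_mult[OF tendsto_power[OF y, of 3] lim_1_over_n]] by simp
  have e1: "e1 \<longlonglongrightarrow> 0"
    by (rule Lim_null_comparison[OF _ err])
      (use uv in eventually_elim, use clustering_expansion(1) in \<open>simp add: e1_def A_def R_def d1_def\<close>)
  have e2: "e2 \<longlonglongrightarrow> 0"
    by (rule Lim_null_comparison[OF _ err])
      (use uv in eventually_elim, use clustering_expansion(2) in \<open>simp add: e2_def B_def R_def d2_def k_def\<close>)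
  have mA: "real m ^ 2 * A m = R m * (1 + d1 m) + e1 m" for m
    by (simp add: e1_def)
  have mB: "real m ^ 2 * B m = R m * (1 + d2 m) + k m + e2 m" for m
    by (simp add: e2_def)
  have ratio: "\<forall>\<^sub>F m in sequentially. (R m * (1 + d1 m) + e1 m) / (R m * (1 + d2 m) + k m + e2 m) = A m / B m"
    using m1 by eventually_elim (simp flip: mA mB)
  {
    assume R: "R \<longlonglongrightarrow> \<rho>" and nz: "\<rho> + \<kappa>\<^sup>2 \<noteq> 0"
    have "(\<lambda>m. (R m * (1 + d1 m) + e1 m) / (R m * (1 + d2 m) + k m + e2 m))
        \<longlonglongrightarrow> (\<rho> * (1 + 0) + 0) / (\<rho> * (1 + 0) + \<kappa>\<^sup>2 + 0)"
      by (intro tendsto_intros R d1 d2 e1 e2 k) (use nz in simp)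
    then show "(\<lambda>m. A m / B m) \<longlonglongrightarrow> \<rho> / (\<rho> + \<kappa>\<^sup>2)"
      using Lim_transform_eventually[OF _ ratio] by simp
  }
  {
    assume R: "filterlim R at_top sequentially"
    have invR: "(\<lambda>m. inverse (R m)) \<longlonglongrightarrow> 0"
      by (rule tendsto_inverse_0_at_top[OF R])
    have "\<forall>\<^sub>F m in sequentially. R m > 0"
      using R by (simp add: filterlim_at_top_dense)
    \<comment> \<open>Dividing by \<open>R m\<close> makes every term except the leading 1 vanish,
      including the bounded path contribution \<open>k m\<close>.\<close>
    then have "\<forall>\<^sub>F m in sequentially. (1 + d1 m + e1 m * inverse (R m)) / (1 + d2 m + (k m + e2 m) * inverse (R m)) = A m / B m"
      using ratio
    proof eventually_elim
      case (elim m)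
      have "(1 + d1 m + e1 m * inverse (R m)) / (1 + d2 m + (k m + e2 m) * inverse (R m))
          = (R m * (1 + d1 m + e1 m * inverse (R m))) / (R m * (1 + d2 m + (k m + e2 m) * inverse (R m)))"
        using elim(1) by simp
      also have "\<dots> = (R m * (1 + d1 m) + e1 m) / (R m * (1 + d2 m) + k m + e2 m)"
        using elim(1) by (intro arg_cong2[where f="(/)"]) (simp_all add: field_simps)
      finally show ?case using elim(2) by simp
    qed
    moreover have "(\<lambda>m. (1 + d1 m + e1 m * inverse (R m)) / (1 + d2 m + (k m + e2 m) * inverse (R m)))
        \<longlonglongrightarrow> (1 + 0 + 0 * 0) / (1 + 0 + (\<kappa>\<^sup>2 + 0) * 0)"
      by (intro tendsto_intros d1 d2 e1 e2 k invR) simp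
    ultimately show "(\<lambda>m. A m / B m) \<longlonglongrightarrow> 1"
      using Lim_transform_eventually by fastforce
  }
qed

section \<open>Factorial moments of \<open>P m\<close> and the scaled pair and triple
  probabilities\<close>

lemma choose_2_eq: "real (k choose 2) = real k * (real k - 1) / 2"
  using binomial_gbinomial[of k 2, where 'a=real]
  by (simp add: gbinomial_prod_rev numeral_2_eq_2 prod.atLeast0_lessThan_Suc)

lemma choose_3_eq: "real (k choose 3) = real k * (real k - 1) * (real k - 2) / 6"
  using binomial_gbinomial[of k 3, where 'a=real]
  by (simp add: gbinomial_prod_rev numeral_3_eq_3 prod.atLeast0_lessThan_Suc)

lemma falling_3_nonneg: "0 \<le> real k * (real k - 1) * (real k - 2)"
  using choose_3_eq[of k] by simp

lemma scaled_superset_prob_2: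
  assumes n: "(\<lambda>m. real (n m) / real m) \<longlonglongrightarrow> c"
    and x: "(\<lambda>m. measure_pmf.expectation (P m) (\<lambda>k. real k * (real k - 1))) \<longlonglongrightarrow> x"
  shows "(\<lambda>m. real (n m) * real m * superset_prob m (P m) 2) \<longlonglongrightarrow> c * x"
proof (rule Lim_transform_eventually)
  have "(\<lambda>m. real m / (real m - 1)) \<longlonglongrightarrow> 1" by real_asymp
  from tendsto_mult[OF tendsto_mult[OF n this] x]
  show "(\<lambda>m. real (n m) / real m * (real m / (real m - 1))
      * measure_pmf.expectation (P m) (\<lambda>k. real k * (real k - 1))) \<longlonglongrightarrow> c * x" by simp
  show "\<forall>\<^sub>F m in sequentially. real (n m) / real m * (real m / (real m - 1))
      * measure_pmf.expectation (P m) (\<lambda>k. real k * (real k - 1)) = real (n m) * real m * superset_prob m (P m) 2"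
    using eventually_ge_at_top[of 2]
    by eventually_elim (simp add: superset_prob_def choose_2_eq field_simps)
qed

lemma scaled_superset_prob_3:
  fixes n :: "nat \<Rightarrow> nat" and P :: "nat \<Rightarrow> nat pmf"
  defines "X \<equiv> \<lambda>m. measure_pmf.expectation (P m) (\<lambda>k. real k * (real k - 1) * (real k - 2))"
    and "R \<equiv> \<lambda>m. real (n m) * real m ^ 2 * superset_prob m (P m) 3"
  assumes n: "(\<lambda>m. real (n m) / real m) \<longlonglongrightarrow> c"
  shows scaled_superset_prob_3_finite: "X \<longlonglongrightarrow> x \<Longrightarrow> R \<longlonglongrightarrow> c * x"
    and scaled_superset_prob_3_infinite: "c > 0 \<Longrightarrow> filterlim X at_top sequentially \<Longrightarrow> filterlim R at_top sequentially"
proof -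
  let ?a = "\<lambda>m. real (n m) / real m * (real m ^ 2 / ((real m - 1) * (real m - 2)))"
  have "(\<lambda>m. real m ^ 2 / ((real m - 1) * (real m - 2))) \<longlonglongrightarrow> 1" by real_asymp
  from tendsto_mult[OF n this] have a: "?a \<longlonglongrightarrow> c" by simp
  have eq: "\<forall>\<^sub>F m in sequentially. ?a m * X m = R m"
    using eventually_ge_at_top[of 3]
  proof eventually_elim
    case (elim m)
    then show ?case
      unfolding R_def X_def superset_prob_def choose_3_eq by (simp add: divide_simps power2_eq_square)
  qed
  show "R \<longlonglongrightarrow> c * x" if "X \<longlonglongrightarrow> x"
    using Lim_transform_eventually[OF tendsto_mult[OF a that] eq] .
  show "filterlim R at_top sequentially" if "c > 0" "filterlim X at_top sequentially"
    using filterlim_tendsto_pos_mult_at_top[OF a that] filterlim_cong[OF refl refl eq] by blast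
qed

theorem theorem3p2:
  fixes \<beta> :: real
    and n :: "nat \<Rightarrow> nat" and P :: "nat \<Rightarrow> nat pmf"
    and Q :: "nat pmf"
    and M :: "'a measure" and \<Lambda> :: "'a \<Rightarrow> nat" and Zt :: "nat \<Rightarrow> 'a \<Rightarrow> nat" and dstar :: "'a \<Rightarrow> nat"
  assumes "\<beta> > 0"
    and "filterlim n at_top sequentially"
    and "(\<lambda>m. real m / real (n m)) \<longlonglongrightarrow> \<beta>"
    and "\<And>m. set_pmf (P m) \<subseteq> {0..m}"
    \<comment> \<open>\<open>X\<^sub>1\<close> has law \<open>P m\<close>, and \<open>Z\<close> has law \<open>Q\<close>\<close>
    and "weak_conv_m (\<lambda>m. distr (measure_pmf (P m)) borel real) (distr (measure_pmf Q) borel real)"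
    and "integrable (measure_pmf Q) (\<lambda>z. real z ^ 2)"
    and "measure_pmf.expectation Q (\<lambda>z. real z ^ 2) > 0"
    and "(\<lambda>m. measure_pmf.expectation (P m) (\<lambda>x. real x ^ 2))
           \<longlonglongrightarrow> measure_pmf.expectation Q (\<lambda>z. real z ^ 2)"
    and "prob_space M"
    \<comment> \<open>mutual independence of \<open>\<Lambda>, Zt 1, Zt 2, \<dots>\<close>: index \<open>0\<close> carries \<open>\<Lambda>\<close>\<close>
    and "prob_space.indep_vars M (\<lambda>_. count_space UNIV) (\<lambda>i. if i = 0 then \<Lambda> else Zt i) {0..}"
    and "\<And>j. j \<ge> 1 \<Longrightarrow> distr M (count_space UNIV) (Zt j) = measure_pmf (size_biased_pmf Q)"
    and "distr M (count_space UNIV) \<Lambda> =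
           measure_pmf (poisson_pmf (inverse \<beta> * measure_pmf.expectation Q real))"
    and "\<And>\<omega>. dstar \<omega> = (\<Sum>j = 1..\<Lambda> \<omega>. Zt j \<omega>)"
  shows "weak_conv_m
           (\<lambda>m. distr (measure_pmf (intersection_sample_pmf (n m) m (P m))) borel
                  (\<lambda>D. real (passive_degree (n m) m D 1)))
           (distr M borel (\<lambda>\<omega>. real (dstar \<omega>)))
    \<and> (measure_pmf.prob Q {z. z \<ge> 2} > 0
         \<and> integrable (measure_pmf Q) (\<lambda>z. real z ^ 3)
         \<and> ((\<lambda>m. measure_pmf.expectation (P m) (\<lambda>x. real x ^ 3))
              \<longlonglongrightarrow> measure_pmf.expectation Q (\<lambda>z. real z ^ 3))
       \<longrightarrow> ((\<lambda>m. clustering_coeff (n m) m (P m)) \<longlonglongrightarrow>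
              (prob_space.expectation M (\<lambda>\<omega>. real (dstar \<omega>) * (real (dstar \<omega>) - 1))
                 - (prob_space.expectation M (\<lambda>\<omega>. real (dstar \<omega>)))\<^sup>2)
              / prob_space.expectation M (\<lambda>\<omega>. real (dstar \<omega>) * (real (dstar \<omega>) - 1))))
    \<and> ((\<integral>\<^sup>+ z. ennreal (real z ^ 3) \<partial>measure_pmf Q) = \<infinity>
       \<longrightarrow> ((\<lambda>m. clustering_coeff (n m) m (P m)) \<longlonglongrightarrow> 1))"
proof -
  note n_top = assms(2) and P = assms(4) and sq_int = assms(6) and sq_lim = assms(8)
  let ?EZ = "measure_pmf.expectation Q real"
  have n_m: "(\<lambda>m. real (n m) / real m) \<longlonglongrightarrow> inverse \<beta>"
    using tendsto_inverse[OF assms(3)] \<open>\<beta> > 0\<close> by simp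
  have conv: "(\<lambda>m. pmf (P m) k) \<longlonglongrightarrow> pmf Q k" for k
    by (rule weak_conv_m_imp_pmf_tendsto[OF assms(5)])
  \<comment> \<open>Each \<open>P m\<close> has finite support, so integrability under it is
    automatic.\<close>
  have intP: "integrable (measure_pmf (P m)) f" for m and f :: "nat \<Rightarrow> real"
    by (rule integrable_measure_pmf_finite) (rule finite_subset[OF P], simp)
  have real_int: "integrable (measure_pmf Q) real"
    by (rule integrable_real_if_square[OF sq_int])
  have EZ: "?EZ > 0"
  proof -
    have "?EZ \<noteq> 0"
    proof
      assume "?EZ = 0"
      then have "AE z in measure_pmf Q. real z = 0"
        using integral_nonneg_eq_0_iff_AE[OF real_int] by simp
      then have "measure_pmf.expectation Q (\<lambda>z. real z ^ 2) = (\<integral>z. 0 \<partial>measure_pmf Q)"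
        by (intro integral_cong_AE) auto
      then show False using assms(7) by simp
    qed
    moreover have "?EZ \<ge> 0" by simp
    ultimately show ?thesis by linarith
  qed
  interpret cp: compound_poisson M \<Lambda> Zt "size_biased_pmf Q" "inverse \<beta> * ?EZ"
    using assms(9-12) \<open>\<beta> > 0\<close> EZ by (intro compound_poisson.intro compound_poisson_axioms.intro) auto
  have dstar: "dstar = (\<lambda>\<omega>. cp.S (\<Lambda> \<omega>) \<omega>)"
    by (simp add: fun_eq_iff assms(13) cp.S_def)
  have graph: "passive_graph m (P m)" if "m \<ge> 3" for m
    using that P by unfold_locales
  have fall2_le: "\<bar>real k * (real k - 1)\<bar> \<le> real k ^ 2" for k
    by (cases k) (auto simp: power2_eq_square)
  have fall2_int: "integrable (measure_pmf Q) (\<lambda>z. real z * (real z - 1))"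
    using Bochner_Integration.integrable_diff[OF sq_int real_int] by (simp add: algebra_simps power2_eq_square)
  let ?x = "measure_pmf.expectation Q (\<lambda>z. real z * (real z - 1))"
  let ?u = "\<lambda>m. superset_prob m (P m) 2" and ?v = "\<lambda>m. superset_prob m (P m) 3"
  have x: "(\<lambda>m. measure_pmf.expectation (P m) (\<lambda>k. real k * (real k - 1))) \<longlonglongrightarrow> ?x"
    by (rule tendsto_expectation_dominated[OF conv intP sq_int sq_lim]) (use fall2_le in simp)
  have y: "(\<lambda>m. real (n m) * real m * ?u m) \<longlonglongrightarrow> inverse \<beta> * ?x"
    by (rule scaled_superset_prob_2[OF n_m x])
  have uv: "\<forall>\<^sub>F m in sequentially. 0 \<le> ?v m \<and> ?v m \<le> ?u m \<and> 3 * ?u m - 2 * ?v m \<le> 1"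
    using eventually_ge_at_top[of 3]
    by eventually_elim (use passive_graph.superset_prob_bounds[OF graph] in blast)
  have clustering: "\<forall>\<^sub>F m in sequentially.
      (1 - 3 * (1 - ?u m) ^ n m + 3 * (1 - 2 * ?u m + ?v m) ^ n m - (1 - 3 * ?u m + 2 * ?v m) ^ n m) /
      (1 - 2 * (1 - ?u m) ^ n m + (1 - 2 * ?u m + ?v m) ^ n m) = clustering_coeff (n m) m (P m)"
    using eventually_ge_at_top[of 3]
    by eventually_elim (simp only: passive_graph.clustering_coeff_eq[OF graph])

  \<comment> \<open>Convergence in distribution of the degree\<close>
  have degree: "weak_conv_m
      (\<lambda>m. distr (measure_pmf (intersection_sample_pmf (n m) m (P m))) borel
        (\<lambda>D. real (passive_degree (n m) m D 1)))
      (distr M borel (\<lambda>\<omega>. real (dstar \<omega>)))"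
  proof (rule levy_continuity)
    fix t :: real
    let ?c = "\<lambda>X m. char (distr (measure_pmf (intersection_sample_pmf (n m) m (P m))) borel (\<lambda>D. real (X m D))) t"
    let ?g = "\<lambda>k. real k *\<^sub>R (1 - iexp (t * real (k - 1)))"
    let ?a = "\<lambda>m. measure_pmf.expectation (P m) ?g" and ?l = "measure_pmf.expectation Q ?g"
    have intPc: "integrable (measure_pmf (P m)) f" for m and f :: "nat \<Rightarrow> complex"
      by (rule integrable_measure_pmf_finite) (rule finite_subset[OF P], simp)
    \<comment> \<open>The bound is quadratic in \<open>k\<close> so that the assumed convergence of
      second moments provides the dominating function.\<close>
    have norm_g: "norm (?g k) \<le> 2 * real k ^ 2" for k
    proof -
      have "norm (1 - iexp (t * real (k - 1))) \<le> 2"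
        using norm_triangle_ineq4[of 1 "iexp (t * real (k - 1))"] by simp
      then have "norm (?g k) \<le> real k * 2"
        by (simp add: mult_left_mono)
      also have "\<dots> \<le> 2 * real k ^ 2"
        using real_le_square[of k] by simp
      finally show ?thesis .
    qed
    have int_g: "integrable (measure_pmf Q) ?g"
      by (rule Bochner_Integration.integrable_bound[of _ "\<lambda>k. 2 * real k ^ 2"])
        (use sq_int norm_g in \<open>auto intro!: AE_I2 order_trans[OF norm_g]\<close>)
    have a: "?a \<longlonglongrightarrow> ?l"
      by (rule tendsto_expectation_dominated[OF conv, of "\<lambda>k. 2 * real k ^ 2"])
        (use sq_int sq_lim norm_g in \<open>auto intro!: intP tendsto_mult_left\<close>)
    have "(\<lambda>m. (1 - ?a m / of_nat m) ^ n m) \<longlonglongrightarrow> exp (- of_real (inverse \<beta>) * ?l)"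
    proof (rule tendsto_power_exp_complex[OF n_m a])
      fix m
      have "Re (?a m) = measure_pmf.expectation (P m) (\<lambda>k. Re (?g k))"
        by (rule integral_Re[OF intPc, symmetric])
      also have "\<dots> \<ge> 0"
        by (rule Bochner_Integration.integral_nonneg) (simp add: exp_eq_polar Re_exp)
      finally show "Re (?a m) \<ge> 0" .
    next
      show "\<forall>\<^sub>F m in sequentially. norm (1 - ?a m / of_nat m) \<le> 1"
        using eventually_ge_at_top[of 3]
      proof eventually_elim
        case (elim m)
        \<comment> \<open>With a single random set the power has exponent 1, so the base
          \<open>1 - ?a m / m\<close> is itself a characteristic function and has modulus at most
          one.\<close>
        interpret passive_graph 1 m "P m" by (rule graph[OF elim])
        interpret D: real_distribution "distr (measure_pmf sample) borel (\<lambda>D. real (degree_sum D))"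
          by (intro prob_space.real_distribution_distr measure_pmf.prob_space_axioms) simp
        show ?case
          using D.cmod_char_le_1[of t] unfolding char_degree_sum by simp
      qed
    qed
    \<comment> \<open>The weight \<open>z\<close> inside \<open>?l\<close> is the size bias; its
      normalisation \<open>?EZ\<close> cancels against the factor \<open>?EZ\<close> in the Poisson
      mean.\<close>
    moreover have "- of_real (inverse \<beta>) * ?l =
        of_real (inverse \<beta> * ?EZ) * (measure_pmf.expectation (size_biased_pmf Q) (\<lambda>z. iexp (t * real z)) - 1)"
    proof -
      have i1: "integrable (measure_pmf Q) (\<lambda>z. complex_of_real (real z))"
        using real_int by (rule integrable_of_real)
      have i2: "integrable (measure_pmf Q) (\<lambda>z. real z *\<^sub>R iexp (t * real (z - 1)))"
        using Bochner_Integration.integrable_diff[OF i1 int_g]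
        by (simp add: scaleR_conv_of_real right_diff_distrib)
      have "?l = (\<integral>z. complex_of_real (real z) - real z *\<^sub>R iexp (t * real (z - 1)) \<partial>measure_pmf Q)"
        by (intro Bochner_Integration.integral_cong) (auto simp: scaleR_conv_of_real right_diff_distrib)
      also have "\<dots> = of_real ?EZ - (\<integral>z. real z *\<^sub>R iexp (t * real (z - 1)) \<partial>measure_pmf Q)"
        by (subst Bochner_Integration.integral_diff[OF i1 i2]) (simp only: integral_of_real[OF real_int])
      also have "(\<integral>z. real z *\<^sub>R iexp (t * real (z - 1)) \<partial>measure_pmf Q) =
          of_real ?EZ * measure_pmf.expectation (size_biased_pmf Q) (\<lambda>z. iexp (t * real z))"
        using size_biased_pmf_expectation(2)[OF real_int EZ i2] EZ by (simp add: scaleR_conv_of_real)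
      finally have l: "?l = of_real ?EZ
          - of_real ?EZ * measure_pmf.expectation (size_biased_pmf Q) (\<lambda>z. iexp (t * real z))" .
      show ?thesis
        unfolding l by (simp add: algebra_simps)
    qed
    ultimately have "(\<lambda>m. (1 - ?a m / of_nat m) ^ n m) \<longlonglongrightarrow> char (distr M borel (\<lambda>\<omega>. real (dstar \<omega>))) t"
      unfolding dstar cp.char_compound_poisson by simp
    moreover have "\<forall>\<^sub>F m in sequentially. (1 - ?a m / of_nat m) ^ n m = ?c (\<lambda>m. passive_graph.degree_sum (n m)) m"
      using eventually_ge_at_top[of 3]
      by eventually_elim (simp only: passive_graph.char_degree_sum[OF graph])
    ultimately have S: "?c (\<lambda>m. passive_graph.degree_sum (n m)) \<longlonglongrightarrow> char (distr M borel (\<lambda>\<omega>. real (dstar \<omega>))) t"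
      by (rule Lim_transform_eventually)
    \<comment> \<open>The passage from \<open>degree_sum\<close> to the degree costs at most
      \<open>2 * (n * m * u)^2 / m\<close>, by the union bound.\<close>
    have "(\<lambda>m. ?c (\<lambda>m D. passive_degree (n m) m D 1) m - ?c (\<lambda>m. passive_graph.degree_sum (n m)) m) \<longlonglongrightarrow> 0"
    proof (rule Lim_null_comparison)
      show "(\<lambda>m. 2 * ((real (n m) * real m * ?u m)\<^sup>2 * (1 / real m))) \<longlonglongrightarrow> 0"
        using tendsto_mult[OF tendsto_const[of 2] tendsto_mult[OF tendsto_power[OF y, of 2] lim_1_over_n]] by simp
      show "\<forall>\<^sub>F m in sequentially. norm (?c (\<lambda>m D. passive_degree (n m) m D 1) m
          - ?c (\<lambda>m. passive_graph.degree_sum (n m)) m) \<le> 2 * ((real (n m) * real m * ?u m)\<^sup>2 * (1 / real m))"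
        using eventually_ge_at_top[of 3]
      proof eventually_elim
        case (elim m)
        have "(real (n m) * real m * ?u m)\<^sup>2 * (1 / real m) = real (n m) ^ 2 * real m * (?u m)\<^sup>2"
          using elim by (simp add: power2_eq_square)
        then show ?case
          using passive_graph.norm_char_degree_diff_le[OF graph[OF elim], of "n m" t] by simp
      qed
    qed
    from tendsto_add[OF this S]
    show "?c (\<lambda>m D. passive_degree (n m) m D 1) \<longlonglongrightarrow> char (distr M borel (\<lambda>\<omega>. real (dstar \<omega>))) t"
      by simp
  next
    show "real_distribution (distr (measure_pmf (intersection_sample_pmf (n m) m (P m))) borel
        (\<lambda>D. real (passive_degree (n m) m D 1)))" for m
      by (intro prob_space.real_distribution_distr measure_pmf.prob_space_axioms) simp
    show "real_distribution (distr M borel (\<lambda>\<omega>. real (dstar \<omega>)))"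
      unfolding dstar by (intro cp.real_distribution_distr) measurable
  qed

  \<comment> \<open>Clustering under a finite third moment\<close>
  have finite_case: "(\<lambda>m. clustering_coeff (n m) m (P m)) \<longlonglongrightarrow>
      (prob_space.expectation M (\<lambda>\<omega>. real (dstar \<omega>) * (real (dstar \<omega>) - 1))
         - (prob_space.expectation M (\<lambda>\<omega>. real (dstar \<omega>)))\<^sup>2)
      / prob_space.expectation M (\<lambda>\<omega>. real (dstar \<omega>) * (real (dstar \<omega>) - 1))"
    if pos: "measure_pmf.prob Q {z. z \<ge> 2} > 0" and cube_int: "integrable (measure_pmf Q) (\<lambda>z. real z ^ 3)"
      and cube_lim: "(\<lambda>m. measure_pmf.expectation (P m) (\<lambda>x. real x ^ 3))
        \<longlonglongrightarrow> measure_pmf.expectation Q (\<lambda>z. real z ^ 3)"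
  proof -
    let ?f = "\<lambda>z. real z * (real z - 1) * (real z - 2)"
    let ?w = "measure_pmf.expectation Q ?f"
    have f_le: "norm (?f z) \<le> real z ^ 3" for z
    proof -
      have "?f z \<le> real z * real z * real z"
      proof (cases "z \<ge> 2")
        case True
        then show ?thesis by (intro mult_mono) auto
      next
        case False
        then have "z = 0 \<or> z = 1" by auto
        then show ?thesis by auto
      qed
      then show ?thesis
        using falling_3_nonneg[of z] by (simp only: real_norm_def abs_of_nonneg power3_eq_cube)
    qed
    have f_int: "integrable (measure_pmf Q) ?f"
      by (rule Bochner_Integration.integrable_bound[OF cube_int])
        (use f_le in \<open>auto intro!: AE_I2 simp: power_abs\<close>)
    have w: "(\<lambda>m. measure_pmf.expectation (P m) ?f) \<longlonglongrightarrow> ?w"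
      by (rule tendsto_expectation_dominated[OF conv intP cube_int cube_lim f_le])
    \<comment> \<open>Positive mass on values at least 2 makes the second factorial moment of
      \<open>Z\<close> positive, which keeps the limiting denominator away from 0.\<close>
    have x_pos: "?x > 0"
    proof -
      have nonneg: "0 \<le> real z * (real z - 1)" for z by (cases z) auto
      have "?x \<noteq> 0"
      proof
        assume "?x = 0"
        then have "AE z in measure_pmf Q. real z * (real z - 1) = 0"
          using integral_nonneg_eq_0_iff_AE[OF fall2_int] nonneg by simp
        then have "AE z in measure_pmf Q. z \<notin> {z. z \<ge> 2}"
          by eventually_elim auto
        then have "measure_pmf.prob Q {z. z \<ge> 2} = 0"
          by (subst measure_pmf.prob_eq_0) auto
        with pos show False by simp
      qed
      moreover have "?x \<ge> 0" using nonneg by simp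
      ultimately show ?thesis by linarith
    qed
    have w_nonneg: "?w \<ge> 0" by (intro Bochner_Integration.integral_nonneg falling_3_nonneg)
    \<comment> \<open>Truncation in \<open>z - 1\<close> is harmless since the factor
      \<open>z\<close> vanishes at 0. These identities turn size-biased moments into factorial
      moments of \<open>Z\<close> one order higher.\<close>
    have shift: "real z * real (z - 1) = real z * (real z - 1)"
      "real z * (real (z - 1) * (real (z - 1) - 1)) = ?f z"
      "real z * real (z - 1) ^ 2 = ?f z + real z * (real z - 1)" for z
      by (cases z; simp add: algebra_simps power2_eq_square)+
    have sb2: "integrable (measure_pmf (size_biased_pmf Q)) (\<lambda>z. real z ^ 2)"
      by (intro size_biased_pmf_expectation(1)[OF real_int EZ])
        (unfold real_scaleR_def shift, intro Bochner_Integration.integrable_add f_int fall2_int)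
    have e1: "measure_pmf.expectation (size_biased_pmf Q) real = ?x / ?EZ"
      using size_biased_pmf_expectation(2)[OF real_int EZ, of real]
      unfolding real_scaleR_def shift using fall2_int by (simp add: divide_inverse mult.commute)
    have e2: "measure_pmf.expectation (size_biased_pmf Q) (\<lambda>z. real z * (real z - 1)) = ?w / ?EZ"
      using size_biased_pmf_expectation(2)[OF real_int EZ, of "\<lambda>z. real z * (real z - 1)"]
      unfolding real_scaleR_def shift using f_int by (simp add: divide_inverse mult.commute)
    have mean: "(\<integral>\<omega>. real (dstar \<omega>) \<partial>M) = inverse \<beta> * ?x"
      unfolding dstar cp.moments_compound_poisson(1)[OF sb2] e1 using EZ by simp
    have second: "(\<integral>\<omega>. real (dstar \<omega>) * (real (dstar \<omega>) - 1) \<partial>M) = inverse \<beta> * ?w + (inverse \<beta> * ?x)\<^sup>2"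
      unfolding dstar cp.moments_compound_poisson(2)[OF sb2] e1 e2 using EZ
      by (simp add: power_mult_distrib power_divide)
    have "inverse \<beta> * ?w + (inverse \<beta> * ?x)\<^sup>2 > 0"
      using \<open>\<beta> > 0\<close> x_pos w_nonneg by (intro add_nonneg_pos) auto
    then have "inverse \<beta> * ?w + (inverse \<beta> * ?x)\<^sup>2 \<noteq> 0" by simp
    \<comment> \<open>With \<open>\<kappa> = inverse \<beta> * ?x\<close> and
      \<open>\<rho> = inverse \<beta> * ?w\<close>, the mean of \<open>dstar\<close> is
      \<open>\<kappa>\<close> and its second factorial moment is \<open>\<rho> + \<kappa>^2\<close>,
      so the limit is the stated quotient.\<close>
    from clustering_limit_finite[OF n_top uv y scaled_superset_prob_3_finite[OF n_m w] this]
    show ?thesis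
      unfolding mean second using Lim_transform_eventually[OF _ clustering] by simp
  qed

  \<comment> \<open>Clustering under an infinite third moment\<close>
  have infinite_case: "(\<lambda>m. clustering_coeff (n m) m (P m)) \<longlonglongrightarrow> 1"
    if inf: "(\<integral>\<^sup>+ z. ennreal (real z ^ 3) \<partial>measure_pmf Q) = \<infinity>"
  proof -
    let ?f = "\<lambda>z. real z * (real z - 1) * (real z - 2)"
    \<comment> \<open>Transfers divergence from the cube to the falling factorial that determines
      \<open>?v\<close>. For \<open>z \<ge> 3\<close> both \<open>z - 1\<close> and
      \<open>z - 2\<close> are at least \<open>z / 3\<close>, so already 9 times \<open>?f z\<close>
      dominates the cube; the summand 8 covers \<open>z \<le> 2\<close>.\<close>
    have cube_le: "real z ^ 3 \<le> 8 + 27 * ?f z" for z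
    proof (cases "z \<ge> 3")
      case True
      have "(real z) * (real z / 3) * (real z / 3) \<le> real z * (real z - 1) * (real z - 2)"
        using True by (intro mult_mono) auto
      then show ?thesis using falling_3_nonneg[of z] by (simp add: power3_eq_cube)
    next
      case False
      then have "z = 0 \<or> z = 1 \<or> z = 2" by auto
      then show ?thesis by auto
    qed
    have "(\<integral>\<^sup>+ z. ennreal (?f z) \<partial>measure_pmf Q) = \<infinity>"
    proof (rule ccontr)
      assume "(\<integral>\<^sup>+ z. ennreal (?f z) \<partial>measure_pmf Q) \<noteq> \<infinity>"
      then have fin: "(\<integral>\<^sup>+ z. ennreal (?f z) \<partial>measure_pmf Q) < \<infinity>"
        by (simp add: less_top)
      have "(\<integral>\<^sup>+ z. ennreal (real z ^ 3) \<partial>measure_pmf Q) \<le> (\<integral>\<^sup>+ z. 8 + 27 * ennreal (?f z) \<partial>measure_pmf Q)"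
      proof (rule nn_integral_mono)
        fix z
        have "ennreal (real z ^ 3) \<le> ennreal (8 + 27 * ?f z)"
          by (rule ennreal_leI[OF cube_le])
        also have "\<dots> = 8 + 27 * ennreal (?f z)"
          using falling_3_nonneg[of z] by (subst ennreal_plus) (simp_all add: ennreal_mult)
        finally show "ennreal (real z ^ 3) \<le> 8 + 27 * ennreal (?f z)" .
      qed
      also have "\<dots> = 8 + 27 * (\<integral>\<^sup>+ z. ennreal (?f z) \<partial>measure_pmf Q)"
        by (subst nn_integral_add) (auto simp: nn_integral_cmult)
      also have "\<dots> < \<infinity>"
        using fin by (simp add: ennreal_mult_less_top)
      finally show False using inf by simp
    qed
    then have "filterlim (\<lambda>m. measure_pmf.expectation (P m) ?f) at_top sequentially"
      by (rule expectation_at_top_if_nn_integral_infinite[OF conv intP falling_3_nonneg])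
    then have "filterlim (\<lambda>m. real (n m) * real m ^ 2 * ?v m) at_top sequentially"
      using \<open>\<beta> > 0\<close> by (intro scaled_superset_prob_3_infinite[OF n_m]) auto
    from clustering_limit_infinite[OF n_top uv y this]
    show ?thesis
      using Lim_transform_eventually[OF _ clustering] by simp
  qed

  show ?thesis
    using degree finite_case infinite_case by blast
qed

end
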